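(* There is a monoid defined by a finite complete presentation for which the $c$-conjugacy problem is undecidable.
   Context: A presentation $(\Sigma;R)$ consists of a nonempty set $\Sigma$ (alphabet) and a rewriting system $R\subseteq\Sigma^*\times\Sigma^*$; it defines the monoid $M(\Sigma;R)=\Sigma^*/\rho_R$, where $\rho_R$ is the smallest congruence on $\Sigma^*$ containing $R$. It is finite if $\Sigma$ and $R$ are finite. Write $uxv\to uyv$ whenever $(x,y)\in R$ and $u,v\in\Sigma^*$, and let $\stackrel{*}{\to}$ be the reflexive and transitive closure of $\to$. The presentation is noetherian if there is no infinite sequence $w_1\to w_2\to\cdots$; confluent if whenever $u\stackrel{*}{\to}v$ and $u\stackrel{*}{\to}w$ there is $z$ with $v\stackrel{*}{\to}z$ and $w\stackrel{*}{\to}z$; complete if it is both noetherian and confluent. For a monoid $M$ with zero and $a\in M\setminus\{0\}$, let $\mathbb P(a)=\{g\in M:(\forall m\in M)\ mag=0\Rightarrow ma=0\}$, and let $\mathbb P(0)=\{0\}$; if $M$ has no zero, $\mathbb P(a)=M$ for all $a\in M$. Define $a\sim_c b$ to mean: there exist $g\in\mathbb P(a)$ and $h\in\mathbb P(b)$ with $ag=gb$ and $bh=ha$. The $c$-conjugacy problem for $M=M(\Sigma;R)$ (with $(\Sigma;R)$ finite) is decidable if there is an algorithm that, given any pair $(u,v)$ of words in $\Sigma^*$, returns YES if $[u]_M\sim_c[v]_M$ and NO otherwise, where $[u]_M$ is the element of $M$ represented by $u$; otherwise it is undecidable. *)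

theory Defs
  imports "HOL-Algebra.Group"
begin

section \<open>Presentations and the monoids they define\<close>

text \<open>
  Words over \<open>\<Sigma>\<close> are the lists in \<^term>\<open>lists \<Sigma>\<close>; a rewriting system is a relation on them.
\<close>

definition presentation :: "'a set \<Rightarrow> ('a list \<times> 'a list) set \<Rightarrow> bool" where
  "presentation \<Sigma> R \<longleftrightarrow> \<Sigma> \<noteq> {} \<and> R \<subseteq> lists \<Sigma> \<times> lists \<Sigma>"

definition finite_presentation :: "'a set \<Rightarrow> ('a list \<times> 'a list) set \<Rightarrow> bool" where
  "finite_presentation \<Sigma> R \<longleftrightarrow> presentation \<Sigma> R \<and> finite \<Sigma> \<and> finite R"

definition word_congruence :: "'a set \<Rightarrow> ('a list \<times> 'a list) set \<Rightarrow> bool" where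
  "word_congruence \<Sigma> C \<longleftrightarrow> equiv (lists \<Sigma>) C \<and>
     (\<forall>(u, v) \<in> C. \<forall>w \<in> lists \<Sigma>. (w @ u, w @ v) \<in> C \<and> (u @ w, v @ w) \<in> C)"

definition generated_congruence ::
    "'a set \<Rightarrow> ('a list \<times> 'a list) set \<Rightarrow> ('a list \<times> 'a list) set" where
  "generated_congruence \<Sigma> R = \<Inter> {C. word_congruence \<Sigma> C \<and> R \<subseteq> C}"

definition word_class ::
    "'a set \<Rightarrow> ('a list \<times> 'a list) set \<Rightarrow> 'a list \<Rightarrow> 'a list set" where
  "word_class \<Sigma> R u = generated_congruence \<Sigma> R `` {u}"

definition presented_monoid ::
    "'a set \<Rightarrow> ('a list \<times> 'a list) set \<Rightarrow> 'a list set monoid" where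
  "presented_monoid \<Sigma> R =
     \<lparr> carrier = lists \<Sigma> // generated_congruence \<Sigma> R,
       mult = (\<lambda>A B. \<Union>u\<in>A. \<Union>v\<in>B. word_class \<Sigma> R (u @ v)),
       one = word_class \<Sigma> R [] \<rparr>"

lemma word_congruence_generated:
  assumes "presentation \<Sigma> R"
  shows "word_congruence \<Sigma> (generated_congruence \<Sigma> R)"
proof -
  have "word_congruence \<Sigma> (lists \<Sigma> \<times> lists \<Sigma>)"
    by (auto simp: word_congruence_def equiv_def refl_on_def sym_def trans_def)
  then have top: "lists \<Sigma> \<times> lists \<Sigma> \<in> {C. word_congruence \<Sigma> C \<and> R \<subseteq> C}"
    using assms by (simp add: presentation_def)
  have mem: "(u, v) \<in> generated_congruence \<Sigma> R \<longleftrightarrow>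
      (\<forall>C. word_congruence \<Sigma> C \<longrightarrow> R \<subseteq> C \<longrightarrow> (u, v) \<in> C)" for u v
    by (auto simp: generated_congruence_def)
  have "generated_congruence \<Sigma> R \<subseteq> lists \<Sigma> \<times> lists \<Sigma>"
    using top unfolding generated_congruence_def by (rule Inter_lower)
  moreover have "refl_on (lists \<Sigma>) (generated_congruence \<Sigma> R)"
    unfolding refl_on_def mem
    by (auto simp: word_congruence_def equiv_def refl_on_def)
  moreover have "sym (generated_congruence \<Sigma> R)"
    unfolding sym_def mem by (meson word_congruence_def equiv_def symE)
  moreover have "trans (generated_congruence \<Sigma> R)"
    unfolding trans_def mem by (meson word_congruence_def equiv_def transE)
  moreover have "(w @ u, w @ v) \<in> generated_congruence \<Sigma> R \<and>
      (u @ w, v @ w) \<in> generated_congruence \<Sigma> R"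
    if "(u, v) \<in> generated_congruence \<Sigma> R" "w \<in> lists \<Sigma>" for u v w
  proof -
    have "(w @ u, w @ v) \<in> C \<and> (u @ w, v @ w) \<in> C"
      if C: "word_congruence \<Sigma> C" "R \<subseteq> C" for C
    proof -
      have "(u, v) \<in> C"
        using \<open>(u, v) \<in> _\<close> C mem by blast
      then show ?thesis
        using C(1) \<open>w \<in> _\<close> unfolding word_congruence_def by blast
    qed
    then show ?thesis
      using mem by simp
  qed
  ultimately show ?thesis
    unfolding word_congruence_def equiv_def by blast
qed

lemma word_class_mult:
  assumes "presentation \<Sigma> R" and "u \<in> lists \<Sigma>" and "v \<in> lists \<Sigma>"
  shows "word_class \<Sigma> R u \<otimes>\<^bsub>presented_monoid \<Sigma> R\<^esub> word_class \<Sigma> R v = word_class \<Sigma> R (u @ v)"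
proof -
  let ?C = "generated_congruence \<Sigma> R"
  have C: "equiv (lists \<Sigma>) ?C"
    and l: "\<And>u v w. (u, v) \<in> ?C \<Longrightarrow> w \<in> lists \<Sigma> \<Longrightarrow> (w @ u, w @ v) \<in> ?C"
    and r: "\<And>u v w. (u, v) \<in> ?C \<Longrightarrow> w \<in> lists \<Sigma> \<Longrightarrow> (u @ w, v @ w) \<in> ?C"
    using word_congruence_generated[OF assms(1)] by (auto simp: word_congruence_def)
  have eq: "word_class \<Sigma> R (u' @ v') = word_class \<Sigma> R (u @ v)"
    if u': "u' \<in> word_class \<Sigma> R u" and v': "v' \<in> word_class \<Sigma> R v" for u' v'
  proof -
    have 1: "(u, u') \<in> ?C" and 2: "(v, v') \<in> ?C"
      using u' v' by (auto simp: word_class_def)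
    have "u' \<in> lists \<Sigma>"
      using 1 C by (auto simp: equiv_def)
    then have "(u @ v, u' @ v') \<in> ?C"
      using r[OF 1 assms(3)] l[OF 2] C by (meson equiv_def transE)
    then show ?thesis
      unfolding word_class_def using equiv_class_eq[OF C] by metis
  qed
  have ne: "u \<in> word_class \<Sigma> R u" "v \<in> word_class \<Sigma> R v"
    unfolding word_class_def using equiv_class_self[OF C] assms(2,3) by blast+
  have "word_class \<Sigma> R u \<otimes>\<^bsub>presented_monoid \<Sigma> R\<^esub> word_class \<Sigma> R v =
      (\<Union>u'\<in>word_class \<Sigma> R u. \<Union>v'\<in>word_class \<Sigma> R v. word_class \<Sigma> R (u' @ v'))"
    by (simp add: presented_monoid_def)
  also have "\<dots> = (\<Union>u'\<in>word_class \<Sigma> R u. \<Union>v'\<in>word_class \<Sigma> R v. word_class \<Sigma> R (u @ v))"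
    by (intro SUP_cong refl eq)
  also have "\<dots> = word_class \<Sigma> R (u @ v)"
    using ne by blast
  finally show ?thesis .
qed

lemma monoid_presented_monoid:
  assumes "presentation \<Sigma> R"
  shows "monoid (presented_monoid \<Sigma> R)"
proof -
  have carr: "x \<in> carrier (presented_monoid \<Sigma> R) \<longleftrightarrow> (\<exists>u\<in>lists \<Sigma>. x = word_class \<Sigma> R u)" for x
    by (auto simp: presented_monoid_def word_class_def quotient_def)
  have one: "\<one>\<^bsub>presented_monoid \<Sigma> R\<^esub> = word_class \<Sigma> R []"
    by (simp add: presented_monoid_def)
  show ?thesis
  proof (rule monoidI)
    fix x y
    assume "x \<in> carrier (presented_monoid \<Sigma> R)" "y \<in> carrier (presented_monoid \<Sigma> R)"
    then obtain u v where "u \<in> lists \<Sigma>" "v \<in> lists \<Sigma>"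
      "x = word_class \<Sigma> R u" "y = word_class \<Sigma> R v"
      unfolding carr by blast
    moreover from this have "u @ v \<in> lists \<Sigma>"
      by simp
    ultimately show "x \<otimes>\<^bsub>presented_monoid \<Sigma> R\<^esub> y \<in> carrier (presented_monoid \<Sigma> R)"
      unfolding carr using word_class_mult[OF assms] by metis
  next
    show "\<one>\<^bsub>presented_monoid \<Sigma> R\<^esub> \<in> carrier (presented_monoid \<Sigma> R)"
      unfolding carr one by (intro bexI[of _ "[]"]) simp_all
  next
    fix x y z
    assume "x \<in> carrier (presented_monoid \<Sigma> R)" "y \<in> carrier (presented_monoid \<Sigma> R)"
      "z \<in> carrier (presented_monoid \<Sigma> R)"
    then obtain u v w where "u \<in> lists \<Sigma>" "v \<in> lists \<Sigma>" "w \<in> lists \<Sigma>"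
      "x = word_class \<Sigma> R u" "y = word_class \<Sigma> R v" "z = word_class \<Sigma> R w"
      unfolding carr by blast
    then show "x \<otimes>\<^bsub>presented_monoid \<Sigma> R\<^esub> y \<otimes>\<^bsub>presented_monoid \<Sigma> R\<^esub> z =
        x \<otimes>\<^bsub>presented_monoid \<Sigma> R\<^esub> (y \<otimes>\<^bsub>presented_monoid \<Sigma> R\<^esub> z)"
      using assms by (simp add: word_class_mult del: in_lists_conv_set)
  next
    fix x
    assume "x \<in> carrier (presented_monoid \<Sigma> R)"
    then obtain u where "u \<in> lists \<Sigma>" "x = word_class \<Sigma> R u"
      unfolding carr by blast
    then show "\<one>\<^bsub>presented_monoid \<Sigma> R\<^esub> \<otimes>\<^bsub>presented_monoid \<Sigma> R\<^esub> x = x"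
      and "x \<otimes>\<^bsub>presented_monoid \<Sigma> R\<^esub> \<one>\<^bsub>presented_monoid \<Sigma> R\<^esub> = x"
      using assms by (simp_all add: one word_class_mult del: in_lists_conv_set)
  qed
qed

section \<open>Complete rewriting systems\<close>

definition rewrite_step ::
    "'a set \<Rightarrow> ('a list \<times> 'a list) set \<Rightarrow> ('a list \<times> 'a list) set" where
  "rewrite_step \<Sigma> R =
     {(u @ x @ v, u @ y @ v) | u x y v. (x, y) \<in> R \<and> u \<in> lists \<Sigma> \<and> v \<in> lists \<Sigma>}"

definition noetherian_presentation :: "'a set \<Rightarrow> ('a list \<times> 'a list) set \<Rightarrow> bool" where
  "noetherian_presentation \<Sigma> R \<longleftrightarrow>
     \<not> (\<exists>w :: nat \<Rightarrow> 'a list. \<forall>i. (w i, w (Suc i)) \<in> rewrite_step \<Sigma> R)"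

definition confluent_presentation :: "'a set \<Rightarrow> ('a list \<times> 'a list) set \<Rightarrow> bool" where
  "confluent_presentation \<Sigma> R \<longleftrightarrow>
     (\<forall>u \<in> lists \<Sigma>. \<forall>v \<in> lists \<Sigma>. \<forall>w \<in> lists \<Sigma>.
        (u, v) \<in> (rewrite_step \<Sigma> R)\<^sup>* \<and> (u, w) \<in> (rewrite_step \<Sigma> R)\<^sup>* \<longrightarrow>
        (\<exists>z \<in> lists \<Sigma>. (v, z) \<in> (rewrite_step \<Sigma> R)\<^sup>* \<and> (w, z) \<in> (rewrite_step \<Sigma> R)\<^sup>*))"

definition complete_presentation :: "'a set \<Rightarrow> ('a list \<times> 'a list) set \<Rightarrow> bool" where
  "complete_presentation \<Sigma> R \<longleftrightarrow> noetherian_presentation \<Sigma> R \<and> confluent_presentation \<Sigma> R"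

section \<open>c-conjugacy\<close>

definition is_zero :: "('m, 'b) monoid_scheme \<Rightarrow> 'm \<Rightarrow> bool" where
  "is_zero M z \<longleftrightarrow> z \<in> carrier M \<and> (\<forall>x \<in> carrier M. z \<otimes>\<^bsub>M\<^esub> x = z \<and> x \<otimes>\<^bsub>M\<^esub> z = z)"

lemma is_zero_unique: "is_zero M z \<Longrightarrow> is_zero M z' \<Longrightarrow> z = z'"
  unfolding is_zero_def by metis

definition zero_of :: "('m, 'b) monoid_scheme \<Rightarrow> 'm" where
  "zero_of M = (THE z. is_zero M z)"

definition c_conjugators :: "('m, 'b) monoid_scheme \<Rightarrow> 'm \<Rightarrow> 'm set" where
  "c_conjugators M a =
     (if \<exists>z. is_zero M z then
        if a = zero_of M then {zero_of M}
        else {g \<in> carrier M. \<forall>m \<in> carrier M.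
                m \<otimes>\<^bsub>M\<^esub> a \<otimes>\<^bsub>M\<^esub> g = zero_of M \<longrightarrow> m \<otimes>\<^bsub>M\<^esub> a = zero_of M}
      else carrier M)"

definition c_conjugate :: "('m, 'b) monoid_scheme \<Rightarrow> 'm \<Rightarrow> 'm \<Rightarrow> bool" where
  "c_conjugate M a b \<longleftrightarrow>
     (\<exists>g \<in> c_conjugators M a. \<exists>h \<in> c_conjugators M b.
        a \<otimes>\<^bsub>M\<^esub> g = g \<otimes>\<^bsub>M\<^esub> b \<and> b \<otimes>\<^bsub>M\<^esub> h = h \<otimes>\<^bsub>M\<^esub> a)"

section \<open>Algorithms: deterministic Turing machines\<close>

datatype move = Move_Left | Move_Right

text \<open>
  The tape alphabet provides the letters of the input words, a blank, a separator between the
  two input words, and an unlimited supply of auxiliary symbols, of which each machine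
  uses only finitely many.
\<close>

datatype 'a tape_symbol = Blank | Separator | Letter 'a | Auxiliary nat

record 'a turing_machine =
  start_state :: nat
  accept_state :: nat
  reject_state :: nat
  transition :: "nat \<times> 'a tape_symbol \<Rightarrow> (nat \<times> 'a tape_symbol \<times> move) option"

text \<open>
  Finiteness of the domain of the transition function makes the set of states and the set of
  tape symbols used by the machine finite.
\<close>

definition valid_turing_machine :: "'a turing_machine \<Rightarrow> bool" where
  "valid_turing_machine T \<longleftrightarrow> finite (dom (transition T)) \<and> accept_state T \<noteq> reject_state T"

text \<open>
  A configuration \<open>(q, ls, rs)\<close> consists of a state, the tape to the left of the head (nearest
  cell first), and the tape from the head on to the right; all cells beyond the
  two lists are blank, so the tape is infinite in both directions.
\<close>

type_synonym 'a configuration = "nat \<times> 'a tape_symbol list \<times> 'a tape_symbol list"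

fun first_symbol :: "'a tape_symbol list \<Rightarrow> 'a tape_symbol" where
  "first_symbol [] = Blank"
| "first_symbol (x # xs) = x"

inductive turing_step :: "'a turing_machine \<Rightarrow> 'a configuration \<Rightarrow> 'a configuration \<Rightarrow> bool"
  for T where
  left: "q \<noteq> accept_state T \<Longrightarrow> q \<noteq> reject_state T \<Longrightarrow>
    transition T (q, first_symbol rs) = Some (q', y, Move_Left) \<Longrightarrow>
    turing_step T (q, ls, rs) (q', tl ls, first_symbol ls # y # tl rs)"
| right: "q \<noteq> accept_state T \<Longrightarrow> q \<noteq> reject_state T \<Longrightarrow>
    transition T (q, first_symbol rs) = Some (q', y, Move_Right) \<Longrightarrow>
    turing_step T (q, ls, rs) (q', y # ls, tl rs)"

definition reaches_state ::
    "'a turing_machine \<Rightarrow> 'a tape_symbol list \<Rightarrow> nat \<Rightarrow> bool" where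
  "reaches_state T w q \<longleftrightarrow>
     (\<exists>ls rs. (turing_step T)\<^sup>*\<^sup>* (start_state T, [], w) (q, ls, rs))"

definition turing_accepts :: "'a turing_machine \<Rightarrow> 'a tape_symbol list \<Rightarrow> bool" where
  "turing_accepts T w \<longleftrightarrow> reaches_state T w (accept_state T)"

definition turing_rejects :: "'a turing_machine \<Rightarrow> 'a tape_symbol list \<Rightarrow> bool" where
  "turing_rejects T w \<longleftrightarrow> reaches_state T w (reject_state T)"

definition pair_input :: "'a list \<Rightarrow> 'a list \<Rightarrow> 'a tape_symbol list" where
  "pair_input u v = map Letter u @ Separator # map Letter v"

definition decidable_word_relation :: "'a set \<Rightarrow> ('a list \<Rightarrow> 'a list \<Rightarrow> bool) \<Rightarrow> bool" where
  "decidable_word_relation \<Sigma> P \<longleftrightarrow>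
     (\<exists>T :: 'a turing_machine. valid_turing_machine T \<and>
        (\<forall>u \<in> lists \<Sigma>. \<forall>v \<in> lists \<Sigma>.
           if P u v then turing_accepts T (pair_input u v)
           else turing_rejects T (pair_input u v)))"

definition c_conjugacy_problem_decidable ::
    "'a set \<Rightarrow> ('a list \<times> 'a list) set \<Rightarrow> bool" where
  "c_conjugacy_problem_decidable \<Sigma> R \<longleftrightarrow>
     decidable_word_relation \<Sigma>
       (\<lambda>u v. c_conjugate (presented_monoid \<Sigma> R) (word_class \<Sigma> R u) (word_class \<Sigma> R v))"

end

theory Submission
  imports Defs "HOL-Library.Countable"
begin

text \<open>
  A nondeterministic machine with two queues is turned into a complete rewriting system in which
  every instruction is a letter, its fuel. A fuel letter entering a configuration \<open>c\<close> from the right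
  travels to the left through it, executes its instruction, and leaves on the left unchanged, so
  \<open>c f = f c'\<close> in the monoid. A halting configuration collapses to a letter \<open>h\<close> that absorbs all
  other letters on its right and lets fuel pass. Hence \<open>c g = g h\<close> is solvable if and only if the
  machine can halt from \<open>c\<close>, whereas \<open>h x = x c\<close> always has the solution \<open>x = h\<close>. No fuel letter ever
  reacts with what follows it, so there is no zero and all elements are admissible conjugators.

  One fixed machine is universal: its first queue holds a list of rules \<open>l \<rightarrow> r\<close>, which rewrite
  \<open>l w\<close> to \<open>w r\<close> in the second one. It starts by appending an encoding of its own program to the
  empty second queue, so that the rules can assemble the word for the initial configuration itself.
  For a Turing machine \<open>T\<close> that is supposed to decide \<open>c\<close>-conjugacy, choose rules simulating \<open>T\<close> on this
  configuration and \<open>h\<close>, and halting if and only if \<open>T\<close> rejects: the two words are then \<open>c\<close>-conjugate if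
  and only if \<open>T\<close> denies it.
\<close>

section \<open>Presentations and joinability\<close>

definition joinable :: "'a set \<Rightarrow> ('a list \<times> 'a list) set \<Rightarrow> 'a list \<Rightarrow> 'a list \<Rightarrow> bool" where
  "joinable \<Sigma> R u v \<longleftrightarrow>
     (\<exists>w. (u, w) \<in> (rewrite_step \<Sigma> R)\<^sup>* \<and> (v, w) \<in> (rewrite_step \<Sigma> R)\<^sup>*)"

lemma rewrite_step_context:
  assumes "(u, v) \<in> rewrite_step \<Sigma> R" and "a \<in> lists \<Sigma>" and "b \<in> lists \<Sigma>"
  shows "(a @ u @ b, a @ v @ b) \<in> rewrite_step \<Sigma> R"
proof -
  obtain p x y s where "(x, y) \<in> R" "p \<in> lists \<Sigma>" "s \<in> lists \<Sigma>" "u = p @ x @ s" "v = p @ y @ s"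
    using assms(1) unfolding rewrite_step_def by blast
  then have "a @ u @ b = (a @ p) @ x @ (s @ b)" "a @ v @ b = (a @ p) @ y @ (s @ b)"
    "a @ p \<in> lists \<Sigma>" "s @ b \<in> lists \<Sigma>"
    using assms(2,3) by auto
  then show ?thesis
    using \<open>(x, y) \<in> R\<close> unfolding rewrite_step_def by blast
qed

lemma rewrite_steps_context:
  assumes "(u, v) \<in> (rewrite_step \<Sigma> R)\<^sup>*" and "a \<in> lists \<Sigma>" and "b \<in> lists \<Sigma>"
  shows "(a @ u @ b, a @ v @ b) \<in> (rewrite_step \<Sigma> R)\<^sup>*"
  using assms(1)
proof (induction rule: rtrancl_induct)
  case (step y z)
  then show ?case
    using rewrite_step_context[OF step.hyps(2) assms(2,3)] by simp
qed simp

lemma rewrite_steps_in_lists: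
  assumes "(u, v) \<in> (rewrite_step \<Sigma> R)\<^sup>*" and "u \<in> lists \<Sigma>" and "presentation \<Sigma> R"
  shows "v \<in> lists \<Sigma>"
  using assms(1,2)
proof (induction rule: rtrancl_induct)
  case (step v w)
  then show ?case
    using assms(3) unfolding rewrite_step_def presentation_def by fastforce
qed

text \<open>Church-Rosser: confluence makes joinability transitive, so it is itself a congruence
  containing \<open>R\<close> and bounds the generated one from above. Conversely every rewriting
  step stays inside the generated congruence.\<close>

lemma generated_congruence_iff_joinable:
  assumes pres: "presentation \<Sigma> R" and conf: "confluent_presentation \<Sigma> R"
  shows "(u, v) \<in> generated_congruence \<Sigma> R \<longleftrightarrow>
    u \<in> lists \<Sigma> \<and> v \<in> lists \<Sigma> \<and> joinable \<Sigma> R u v"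
proof -
  let ?S = "rewrite_step \<Sigma> R"
  let ?J = "{(u, v). u \<in> lists \<Sigma> \<and> v \<in> lists \<Sigma> \<and> joinable \<Sigma> R u v}"
  have "refl_on (lists \<Sigma>) ?J"
    by (auto simp: refl_on_def joinable_def)
  moreover have "sym ?J"
    by (auto simp: sym_def joinable_def)
  moreover have "trans ?J"
  proof (rule transI)
    fix x y z
    assume xy: "(x, y) \<in> ?J" and yz: "(y, z) \<in> ?J"
    obtain p q where p: "(x, p) \<in> ?S\<^sup>*" "(y, p) \<in> ?S\<^sup>*" and q: "(y, q) \<in> ?S\<^sup>*" "(z, q) \<in> ?S\<^sup>*"
      using xy yz unfolding joinable_def by blast
    have l: "x \<in> lists \<Sigma>" "y \<in> lists \<Sigma>" "z \<in> lists \<Sigma>"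
      using xy yz by auto
    then have "p \<in> lists \<Sigma>" "q \<in> lists \<Sigma>"
      using p q rewrite_steps_in_lists[OF _ _ pres] by blast+
    then obtain r where "(p, r) \<in> ?S\<^sup>*" "(q, r) \<in> ?S\<^sup>*"
      using conf p(2) q(1) l(2) unfolding confluent_presentation_def by blast
    then have "(x, r) \<in> ?S\<^sup>*" "(z, r) \<in> ?S\<^sup>*"
      using p(1) q(2) by (meson rtrancl_trans)+
    then show "(x, z) \<in> ?J"
      using l unfolding joinable_def by blast
  qed
  moreover have "(w @ u, w @ v) \<in> ?J \<and> (u @ w, v @ w) \<in> ?J"
    if "(u, v) \<in> ?J" "w \<in> lists \<Sigma>" for u v w
  proof -
    obtain z where z: "(u, z) \<in> ?S\<^sup>*" "(v, z) \<in> ?S\<^sup>*"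
      using \<open>(u, v) \<in> ?J\<close> unfolding joinable_def by blast
    have "joinable \<Sigma> R (w @ u) (w @ v)" "joinable \<Sigma> R (u @ w) (v @ w)"
      unfolding joinable_def
      using rewrite_steps_context[OF z(1) that(2), of "[]"]
        rewrite_steps_context[OF z(2) that(2), of "[]"]
        rewrite_steps_context[OF z(1) _ that(2), of "[]"]
        rewrite_steps_context[OF z(2) _ that(2), of "[]"] by auto
    then show ?thesis
      using that by simp
  qed
  ultimately have "word_congruence \<Sigma> ?J"
    unfolding word_congruence_def equiv_def by blast
  moreover have "R \<subseteq> ?J"
  proof
    fix xy assume "xy \<in> R"
    then obtain x y where xy: "xy = (x, y)" "(x, y) \<in> R" by (cases xy) auto
    then have "x \<in> lists \<Sigma>" "y \<in> lists \<Sigma>"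
      using pres unfolding presentation_def by blast+
    moreover have "([] @ x @ [], [] @ y @ []) \<in> ?S"
      using xy(2) unfolding rewrite_step_def by blast
    ultimately show "xy \<in> ?J"
      unfolding joinable_def using xy(1) by auto
  qed
  ultimately have 1: "generated_congruence \<Sigma> R \<subseteq> ?J"
    unfolding generated_congruence_def by blast
  let ?C = "generated_congruence \<Sigma> R"
  have wc: "word_congruence \<Sigma> ?C"
    by (rule word_congruence_generated[OF pres])
  then have eq: "equiv (lists \<Sigma>) ?C"
    by (simp add: word_congruence_def)
  have "R \<subseteq> ?C"
    unfolding generated_congruence_def by blast
  have one_step: "(a, b) \<in> ?C" if "(a, b) \<in> ?S" for a b
  proof -
    obtain p x y s where h: "(x, y) \<in> R" "p \<in> lists \<Sigma>" "s \<in> lists \<Sigma>" "a = p @ x @ s" "b = p @ y @ s"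
      using \<open>(a, b) \<in> ?S\<close> unfolding rewrite_step_def by blast
    then have "(x @ s, y @ s) \<in> ?C"
      using wc \<open>R \<subseteq> ?C\<close> unfolding word_congruence_def by blast
    then show ?thesis
      using wc h unfolding word_congruence_def by blast
  qed
  have steps: "(a, b) \<in> ?C" if "(a, b) \<in> ?S\<^sup>*" "a \<in> lists \<Sigma>" for a b
    using that
  proof (induction rule: rtrancl_induct)
    case base
    then show ?case using eq by (auto simp: equiv_def refl_on_def)
  next
    case (step b c)
    then have "(a, b) \<in> ?C" "(b, c) \<in> ?C"
      using one_step by simp_all
    then show ?case
      using eq by (meson equiv_def transD)
  qed
  have 2: "?J \<subseteq> ?C"
  proof (rule subrelI, unfold mem_Collect_eq case_prod_conv, elim conjE)
    fix a b
    assume l: "a \<in> lists \<Sigma>" "b \<in> lists \<Sigma>" and "joinable \<Sigma> R a b"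
    then obtain c where "(a, c) \<in> ?S\<^sup>*" "(b, c) \<in> ?S\<^sup>*"
      unfolding joinable_def by blast
    then have "(a, c) \<in> ?C" "(b, c) \<in> ?C"
      using steps l by simp_all
    then show "(a, b) \<in> ?C"
      using eq by (meson equiv_def symD transD)
  qed
  show ?thesis
    using 1 2 by blast
qed

lemma word_class_eq_iff:
  assumes "presentation \<Sigma> R" and "confluent_presentation \<Sigma> R"
    and "u \<in> lists \<Sigma>" and "v \<in> lists \<Sigma>"
  shows "word_class \<Sigma> R u = word_class \<Sigma> R v \<longleftrightarrow> joinable \<Sigma> R u v"
proof -
  have "equiv (lists \<Sigma>) (generated_congruence \<Sigma> R)"
    using word_congruence_generated[OF assms(1)] by (simp add: word_congruence_def)
  then show ?thesis
    unfolding word_class_def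
    using generated_congruence_iff_joinable[OF assms(1,2)] assms(3,4)
    by (simp add: eq_equiv_class_iff)
qed

text \<open>A zero \<open>w\<close> would satisfy \<open>x w = w\<close> for all \<open>x\<close>,
  which \<open>no_zero\<close> forbids. Without a zero every element is an admissible conjugator, so
  only the two equations between words remain.\<close>

lemma c_conjugate_iff_joinable:
  assumes pres: "presentation \<Sigma> R" and conf: "confluent_presentation \<Sigma> R"
    and no_zero: "\<And>w. w \<in> lists \<Sigma> \<Longrightarrow> \<exists>x \<in> lists \<Sigma>. \<not> joinable \<Sigma> R (x @ w) w"
    and u: "u \<in> lists \<Sigma>" and v: "v \<in> lists \<Sigma>"
  shows "c_conjugate (presented_monoid \<Sigma> R) (word_class \<Sigma> R u) (word_class \<Sigma> R v) \<longleftrightarrow>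
    (\<exists>g \<in> lists \<Sigma>. \<exists>h \<in> lists \<Sigma>.
      joinable \<Sigma> R (u @ g) (g @ v) \<and> joinable \<Sigma> R (v @ h) (h @ u))"
proof -
  let ?M = "presented_monoid \<Sigma> R"
  have carr: "carrier ?M = word_class \<Sigma> R ` lists \<Sigma>"
    by (auto simp: presented_monoid_def word_class_def quotient_def)
  have app: "x @ y \<in> lists \<Sigma>" if "x \<in> lists \<Sigma>" "y \<in> lists \<Sigma>" for x y
    using that by simp
  have "\<nexists>z. is_zero ?M z"
  proof
    assume "\<exists>z. is_zero ?M z"
    then obtain w where w: "w \<in> lists \<Sigma>" and "is_zero ?M (word_class \<Sigma> R w)"
      unfolding is_zero_def carr by blast
    obtain x where x: "x \<in> lists \<Sigma>" "\<not> joinable \<Sigma> R (x @ w) w"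
      using no_zero[OF w] by blast
    then have "word_class \<Sigma> R (x @ w) = word_class \<Sigma> R w"
      using \<open>is_zero ?M _\<close> word_class_mult[OF pres x(1) w] unfolding is_zero_def carr by auto
    then show False
      using x(2) word_class_eq_iff[OF pres conf app[OF x(1) w] w] by simp
  qed
  then have "c_conjugators ?M a = word_class \<Sigma> R ` lists \<Sigma>" for a
    unfolding c_conjugators_def carr by (simp only: if_False)
  then show ?thesis
    unfolding c_conjugate_def
    by (simp add: word_class_mult[OF pres] word_class_eq_iff[OF pres conf] app u v
        del: in_lists_conv_set)
qed

text \<open>Newman's lemma, by noetherian induction: join the first steps locally, then apply the
  induction hypothesis at both successors of \<open>x\<close>.\<close>

lemma confluent_if_locally_confluent:
  assumes wf: "wf (S\<inverse>)"
    and local: "\<And>x y z. (x, y) \<in> S \<Longrightarrow> (x, z) \<in> S \<Longrightarrow> \<exists>w. (y, w) \<in> S\<^sup>* \<and> (z, w) \<in> S\<^sup>*"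
  shows "(x, y) \<in> S\<^sup>* \<Longrightarrow> (x, z) \<in> S\<^sup>* \<Longrightarrow> \<exists>w. (y, w) \<in> S\<^sup>* \<and> (z, w) \<in> S\<^sup>*"
proof (induction x arbitrary: y z rule: wf_induct_rule[OF wf])
  case (1 x)
  show ?case
  proof (cases "x = y \<or> x = z")
    case True
    then show ?thesis using 1 by blast
  next
    case False
    then obtain y' z' where y': "(x, y') \<in> S" "(y', y) \<in> S\<^sup>*" and z': "(x, z') \<in> S" "(z', z) \<in> S\<^sup>*"
      using 1(2,3) by (metis converse_rtranclE)
    obtain p where p: "(y', p) \<in> S\<^sup>*" "(z', p) \<in> S\<^sup>*"
      using local y'(1) z'(1) by blast
    obtain q where q: "(y, q) \<in> S\<^sup>*" "(p, q) \<in> S\<^sup>*"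
      using 1(1)[of y'] y' p(1) by blast
    then have "(z', q) \<in> S\<^sup>*"
      using p(2) by (meson rtrancl_trans)
    then obtain r where "(z, r) \<in> S\<^sup>*" "(q, r) \<in> S\<^sup>*"
      using 1(1)[of z'] z' by blast
    then show ?thesis
      using q(1) by (meson rtrancl_trans)
  qed
qed

lemma noetherian_iff_wf: "noetherian_presentation \<Sigma> R \<longleftrightarrow> wf ((rewrite_step \<Sigma> R)\<inverse>)"
  unfolding noetherian_presentation_def wf_iff_no_infinite_down_chain by simp

section \<open>Renaming the letters of a rewriting system along an injection\<close>

abbreviation map_words :: "('a \<Rightarrow> 'b) \<Rightarrow> ('a list \<times> 'a list) set \<Rightarrow> ('b list \<times> 'b list) set" where
  "map_words \<nu> R \<equiv> map_prod (map \<nu>) (map \<nu>) ` R"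

context
  fixes \<nu> :: "'a \<Rightarrow> 'b" and R :: "('a list \<times> 'a list) set"
  assumes inj: "inj \<nu>"
begin

lemma lists_range_iff: "w \<in> lists (range \<nu>) \<longleftrightarrow> (\<exists>w'. w = map \<nu> w')"
  by (auto simp: lists_image simp del: in_lists_conv_set)

text \<open>The system is built over a datatype of letters, whereas the final theorem asks for
  numbers. Words over \<open>range \<nu>\<close> are exactly the images of words, so steps
  correspond in both directions and all properties of rewriting carry over.\<close>

lemma rewrite_step_map:
  "rewrite_step (range \<nu>) (map_words \<nu> R) = map_words \<nu> (rewrite_step UNIV R)" (is "?A = ?B")
proof
  show "?A \<subseteq> ?B"
  proof
    fix p assume "p \<in> ?A"
    then obtain a l r b where h: "(l, r) \<in> R" "a \<in> lists (range \<nu>)" "b \<in> lists (range \<nu>)"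
      "p = (a @ map \<nu> l @ b, a @ map \<nu> r @ b)"
      unfolding rewrite_step_def by auto
    then obtain a' b' where "a = map \<nu> a'" "b = map \<nu> b'"
      unfolding lists_range_iff by blast
    then have "p = map_prod (map \<nu>) (map \<nu>) (a' @ l @ b', a' @ r @ b')"
      using h by simp
    moreover have "(a' @ l @ b', a' @ r @ b') \<in> rewrite_step UNIV R"
      using h(1) unfolding rewrite_step_def by auto
    ultimately show "p \<in> ?B" by blast
  qed
  show "?B \<subseteq> ?A"
  proof
    fix p assume "p \<in> ?B"
    then obtain a l r b where "(l, r) \<in> R" "p = (map \<nu> (a @ l @ b), map \<nu> (a @ r @ b))"
      unfolding rewrite_step_def by auto
    moreover from this have "(map \<nu> l, map \<nu> r) \<in> map_words \<nu> R"
      by (metis map_prod_imageI)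
    moreover have "map \<nu> a \<in> lists (range \<nu>)" "map \<nu> b \<in> lists (range \<nu>)"
      unfolding lists_range_iff by blast+
    ultimately show "p \<in> ?A"
      unfolding rewrite_step_def map_append by blast
  qed
qed

lemma rewrite_steps_map:
  "(map \<nu> u, v) \<in> (rewrite_step (range \<nu>) (map_words \<nu> R))\<^sup>* \<longleftrightarrow>
    (\<exists>v'. v = map \<nu> v' \<and> (u, v') \<in> (rewrite_step UNIV R)\<^sup>*)"
proof
  assume "(map \<nu> u, v) \<in> (rewrite_step (range \<nu>) (map_words \<nu> R))\<^sup>*"
  then show "\<exists>v'. v = map \<nu> v' \<and> (u, v') \<in> (rewrite_step UNIV R)\<^sup>*"
  proof (induction rule: rtrancl_induct)
    case (step v w)
    then obtain v' where v': "v = map \<nu> v'" "(u, v') \<in> (rewrite_step UNIV R)\<^sup>*" by blast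
    moreover obtain w' where "w = map \<nu> w'" "(v', w') \<in> rewrite_step UNIV R"
      using step.hyps(2) inj unfolding rewrite_step_map v'(1) by (auto simp: inj_map_eq_map)
    ultimately show ?case
      using rtrancl_into_rtrancl[of u v' _ w'] by blast
  qed blast
next
  assume "\<exists>v'. v = map \<nu> v' \<and> (u, v') \<in> (rewrite_step UNIV R)\<^sup>*"
  then obtain v' where v: "v = map \<nu> v'" and steps: "(u, v') \<in> (rewrite_step UNIV R)\<^sup>*"
    by blast
  from steps have "(map \<nu> u, map \<nu> v') \<in> (map_words \<nu> (rewrite_step UNIV R))\<^sup>*"
  proof (induction rule: rtrancl_induct)
    case (step y z)
    then have "(map \<nu> y, map \<nu> z) \<in> map_words \<nu> (rewrite_step UNIV R)"
      by (metis map_prod_imageI)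
    with step.IH show ?case by (rule rtrancl_into_rtrancl)
  qed simp
  then show "(map \<nu> u, v) \<in> (rewrite_step (range \<nu>) (map_words \<nu> R))\<^sup>*"
    unfolding rewrite_step_map v .
qed

lemma joinable_map:
  "joinable (range \<nu>) (map_words \<nu> R) (map \<nu> u) (map \<nu> v) \<longleftrightarrow> joinable UNIV R u v"
  unfolding joinable_def rewrite_steps_map using inj by (auto simp: inj_map_eq_map)

lemma noetherian_map:
  assumes "noetherian_presentation UNIV R"
  shows "noetherian_presentation (range \<nu>) (map_words \<nu> R)"
  unfolding noetherian_presentation_def
proof
  assume "\<exists>w. \<forall>i. (w i, w (Suc i)) \<in> rewrite_step (range \<nu>) (map_words \<nu> R)"
  then obtain w where w: "(w i, w (Suc i)) \<in> map_words \<nu> (rewrite_step UNIV R)" for i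
    unfolding rewrite_step_map by blast
  have "\<exists>w'. w i = map \<nu> w'" for i
    using w[of i] by auto
  then obtain w' where w': "w i = map \<nu> (w' i)" for i
    by metis
  have "(w' i, w' (Suc i)) \<in> rewrite_step UNIV R" for i
    using w[of i] unfolding w' using inj by (auto simp: inj_map_eq_map)
  then show False
    using assms unfolding noetherian_presentation_def by blast
qed

lemma confluent_map:
  assumes "confluent_presentation UNIV R"
  shows "confluent_presentation (range \<nu>) (map_words \<nu> R)"
  unfolding confluent_presentation_def
proof (intro ballI impI)
  let ?S = "rewrite_step (range \<nu>) (map_words \<nu> R)"
  fix u v w
  assume "u \<in> lists (range \<nu>)" and "(u, v) \<in> ?S\<^sup>* \<and> (u, w) \<in> ?S\<^sup>*"
  then obtain u' v' w' where h: "u = map \<nu> u'" "v = map \<nu> v'" "w = map \<nu> w'"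
    "(u', v') \<in> (rewrite_step UNIV R)\<^sup>*" "(u', w') \<in> (rewrite_step UNIV R)\<^sup>*"
    using inj unfolding lists_range_iff by (auto simp: rewrite_steps_map inj_map_eq_map)
  then obtain z where "(v', z) \<in> (rewrite_step UNIV R)\<^sup>*" "(w', z) \<in> (rewrite_step UNIV R)\<^sup>*"
    using assms unfolding confluent_presentation_def lists_UNIV by blast
  then have "(v, map \<nu> z) \<in> ?S\<^sup>*" "(w, map \<nu> z) \<in> ?S\<^sup>*"
    using h by (auto simp: rewrite_steps_map)
  then show "\<exists>z \<in> lists (range \<nu>). (v, z) \<in> ?S\<^sup>* \<and> (w, z) \<in> ?S\<^sup>*"
    using lists_range_iff by blast
qed

end

section \<open>A complete presentation for a machine with two queues\<close>

text \<open>
  A configuration is the word made of a \<open>Mark\<close> with the state, the first queue, \<open>Middle\<close>, the second queue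
  and \<open>Final\<close>; the front of each queue is its right end. Fuel turns into \<open>Inner\<close> in the second queue
  and into \<open>Outer\<close> in the first.
\<close>

datatype ('m, 'p, 'c, 'o) queue_letter =
  Mark 'm | First 'p | Middle | Second 'c | Final | Fuel 'o | Inner 'o | Outer 'o | Halt

instance queue_letter :: (finite, finite, finite, finite) finite
proof
  have "(UNIV :: ('a, 'b, 'c, 'd) queue_letter set) =
      range Mark \<union> range First \<union> range Second \<union> range Fuel \<union> range Inner \<union> range Outer \<union>
      {Middle, Final, Halt}"
    (is "_ = ?U")
  proof (intro equalityI subsetI)
    fix x :: "('a, 'b, 'c, 'd) queue_letter"
    show "x \<in> ?U" by (cases x) simp_all
  qed simp
  moreover have "finite ?U"
    by (intro finite_UnI finite_imageI finite finite.insertI finite.emptyI)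
  ultimately show "finite (UNIV :: ('a, 'b, 'c, 'd) queue_letter set)"
    by (rule finite_subset[OF equalityD1])
qed

fun moving :: "('m, 'p, 'c, 'o) queue_letter \<Rightarrow> bool" where
  "moving (Fuel f) = True"
| "moving (Inner f) = True"
| "moving (Outer f) = True"
| "moving _ = False"

fun fuel_of :: "('m, 'p, 'c, 'o) queue_letter \<Rightarrow> ('m, 'p, 'c, 'o) queue_letter list" where
  "fuel_of (Fuel f) = [Fuel f]"
| "fuel_of (Inner f) = [Fuel f]"
| "fuel_of (Outer f) = [Fuel f]"
| "fuel_of _ = []"

abbreviation fuels_of :: "('m, 'p, 'c, 'o) queue_letter list \<Rightarrow> ('m, 'p, 'c, 'o) queue_letter list"
  where "fuels_of w \<equiv> concat (map fuel_of w)"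

text \<open>Instruction \<open>f\<close> applies in mode \<open>src f\<close> when
  \<open>pop1 f\<close> and \<open>pop2 f\<close> stand at the fronts of the queues; it removes them
  and appends \<open>push1 f\<close> and \<open>push2 f\<close> at the backs. The value
  \<open>None\<close> of \<open>dst f\<close> means that \<open>f\<close> halts.\<close>

locale two_queue_machine =
  fixes src :: "'o::finite \<Rightarrow> 'm::finite" and dst :: "'o \<Rightarrow> 'm option"
    and pop1 push1 :: "'o \<Rightarrow> 'p::finite list" and pop2 push2 :: "'o \<Rightarrow> 'c::finite list"
begin

inductive halts :: "'m \<Rightarrow> 'p list \<Rightarrow> 'c list \<Rightarrow> bool" where
  now: "dst f = None \<Longrightarrow> halts (src f) (pop1 f @ P) (pop2 f @ Q)"
| later: "dst f = Some q \<Longrightarrow> halts q (P @ push1 f) (Q @ push2 f) \<Longrightarrow>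
    halts (src f) (pop1 f @ P) (pop2 f @ Q)"

text \<open>One passage from right to left performs one instruction. Fronts are right ends and backs
  are left ends, so \<open>pop2\<close> is removed at \<open>Final\<close>, \<open>pop1\<close> is
  removed and \<open>push2\<close> inserted at \<open>Middle\<close>, and the mode changes at the
  mark, where \<open>push1\<close> is inserted.\<close>

inductive_set base_rules ::
    "(('m, 'p, 'c, 'o) queue_letter list \<times> ('m, 'p, 'c, 'o) queue_letter list) set" where
  enter: "(map Second (rev (pop2 f)) @ [Final, Fuel f], [Inner f, Final]) \<in> base_rules"
| pass_second: "([Second y, Inner f], [Inner f, Second y]) \<in> base_rules"
| cross: "(map First (rev (pop1 f)) @ [Middle, Inner f],
    Outer f # Middle # map Second (rev (push2 f))) \<in> base_rules"
| pass_first: "([First x, Outer f], [Outer f, First x]) \<in> base_rules"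
| leave: "dst f = Some q \<Longrightarrow>
    ([Mark (src f), Outer f], Fuel f # Mark q # map First (rev (push1 f))) \<in> base_rules"
| halt: "dst f = None \<Longrightarrow> ([Mark (src f), Outer f], [Fuel f, Halt]) \<in> base_rules"

text \<open>\<open>Halt\<close> turns \<open>Inner\<close> and \<open>Outer\<close> back into
  \<open>Fuel\<close>. As base rules preserve \<open>fuels_of\<close>, a word behind
  \<open>Halt\<close> leaves the same fuel whether or not it is rewritten first, which closes the
  overlaps with \<open>Halt\<close>.\<close>

definition rules ::
    "(('m, 'p, 'c, 'o) queue_letter list \<times> ('m, 'p, 'c, 'o) queue_letter list) set" where
  "rules = base_rules \<union> range (\<lambda>x. ([Halt, x], fuel_of x @ [Halt]))"

lemma rules_cases [consumes 1, case_names base absorb]: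
  assumes "(l, r) \<in> rules"
  obtains "(l, r) \<in> base_rules" | x where "l = [Halt, x]" "r = fuel_of x @ [Halt]"
  using assms unfolding rules_def by auto

lemma base_rules_subset: "base_rules \<subseteq> rules"
  unfolding rules_def by blast

lemma absorb_rule: "([Halt, x], fuel_of x @ [Halt]) \<in> rules"
  unfolding rules_def by blast

lemma finite_rules: "finite rules"
proof -
  let ?lv = "\<lambda>(f, q). ([Mark (src f), Outer f], Fuel f # Mark q # map First (rev (push1 f)))"
  have "base_rules \<subseteq>
      range (\<lambda>f. (map Second (rev (pop2 f)) @ [Final, Fuel f], [Inner f, Final])) \<union>
      range (\<lambda>(y, f). ([Second y, Inner f], [Inner f, Second y])) \<union>
      range (\<lambda>f. (map First (rev (pop1 f)) @ [Middle, Inner f],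
        Outer f # Middle # map Second (rev (push2 f)))) \<union>
      range (\<lambda>(x, f). ([First x, Outer f], [Outer f, First x])) \<union>
      range ?lv \<union> range (\<lambda>f. ([Mark (src f), Outer f], [Fuel f, Halt]))" (is "_ \<subseteq> ?U")
  proof (rule subrelI)
    fix l r assume "(l, r) \<in> base_rules"
    then show "(l, r) \<in> ?U"
      by cases (auto simp: image_iff split: prod.splits)
  qed
  moreover have "finite ?U"
    by (intro finite_UnI finite_imageI finite)
  ultimately have "finite base_rules"
    by (rule finite_subset)
  then show ?thesis
    unfolding rules_def by (intro finite_UnI finite_imageI finite)
qed

abbreviation step where "step \<equiv> rewrite_step UNIV rules"

lemma step_iff:
  "(u, v) \<in> step \<longleftrightarrow> (\<exists>a l r b. (l, r) \<in> rules \<and> u = a @ l @ b \<and> v = a @ r @ b)"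
  unfolding rewrite_step_def by auto

lemma step_base: "(l, r) \<in> base_rules \<Longrightarrow> (a @ l @ b, a @ r @ b) \<in> step"
  unfolding step_iff using base_rules_subset by blast

lemma steps_context: "(u, v) \<in> step\<^sup>* \<Longrightarrow> (a @ u @ b, a @ v @ b) \<in> step\<^sup>*"
  by (rule rewrite_steps_context) simp_all

lemma fuels_of_static [simp]:
  "concat (map (fuel_of \<circ> First) xs) = []" "concat (map (fuel_of \<circ> Second) ys) = []"
proof -
  show "concat (map (fuel_of \<circ> First) xs) = []" by (induction xs) simp_all
  show "concat (map (fuel_of \<circ> Second) ys) = []" by (induction ys) simp_all
qed

text \<open>The shape on which termination and confluence rest: the only moving letter of a
  left-hand side goes from its right end to the left end of the right-hand side.\<close>

lemma base_rule_shape: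
  assumes "(l, r) \<in> base_rules"
  shows "\<exists>xs m m' ys. l = xs @ [m] \<and> xs \<noteq> [] \<and> moving m \<and> Halt \<notin> set l \<and>
    (\<forall>x\<in>set xs. \<not> moving x) \<and> r = m' # ys \<and> moving m' \<and> (\<forall>y\<in>set ys. \<not> moving y) \<and>
    fuels_of r = fuels_of l"
  using assms
proof cases
  case (enter f)
  show ?thesis
    unfolding enter
    by (rule exI[of _ "map Second (rev (pop2 f)) @ [Final]"], rule exI[of _ "Fuel f"], auto)
next
  case (pass_second y f)
  show ?thesis
    unfolding pass_second
    by (rule exI[of _ "[Second y]"], rule exI[of _ "Inner f"], auto)
next
  case (cross f)
  show ?thesis
    unfolding cross
    by (rule exI[of _ "map First (rev (pop1 f)) @ [Middle]"], rule exI[of _ "Inner f"], auto)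
next
  case (pass_first y f)
  show ?thesis
    unfolding pass_first
    by (rule exI[of _ "[First y]"], rule exI[of _ "Outer f"], auto)
next
  case (leave f q)
  show ?thesis
    unfolding leave
    by (rule exI[of _ "[Mark (src f)]"], rule exI[of _ "Outer f"], auto)
next
  case (halt f)
  show ?thesis
    unfolding halt
    by (rule exI[of _ "[Mark (src f)]"], rule exI[of _ "Outer f"], auto)
qed

lemma snoc_pair_eq:
  "xs @ [a, b] = ys @ [c, d] \<longleftrightarrow> xs = ys \<and> a = c \<and> b = d"
  "[a, b] = ys @ [c, d] \<longleftrightarrow> ys = [] \<and> a = c \<and> b = d"
  "xs @ [a, b] = ys @ zs @ [c, d] \<longleftrightarrow> xs = ys @ zs \<and> a = c \<and> b = d"
  "[a, b] = ys @ zs @ [c, d] \<longleftrightarrow> ys = [] \<and> zs = [] \<and> a = c \<and> b = d"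
  using append_eq_append_conv[of xs "ys @ zs" "[a, b]" "[c, d]"]
    append_eq_append_conv[of "[]" "ys @ zs" "[a, b]" "[c, d]"]
    append_eq_append_conv[of xs ys "[a, b]" "[c, d]"]
    append_eq_append_conv[of "[]" ys "[a, b]" "[c, d]"]
  by (auto simp del: append_eq_append_conv)

text \<open>The last two letters of a left-hand side name the instruction and the place of its fuel,
  and thereby determine the whole rule; at a mark, \<open>dst f\<close> decides between
  \<open>leave\<close> and \<open>halt\<close>.\<close>

lemma base_rules_suffix_unique:
  assumes "(d @ l, r) \<in> base_rules" and "(l, r') \<in> base_rules"
  shows "d = [] \<and> r = r'"
  using assms(2,1) by cases (erule base_rules.cases; auto simp: snoc_pair_eq)+

text \<open>Each letter adds one and each moving letter also multiplies by a large constant, so moving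
  letters lose weight when they travel to the left past static ones.\<close>

definition weight_factor :: nat where
  "weight_factor = 3 + (\<Sum>f\<in>UNIV. length (push1 f) + length (push2 f))"

definition weight :: "nat \<Rightarrow> ('m, 'p, 'c, 'o) queue_letter list \<Rightarrow> nat" where
  "weight = foldl (\<lambda>n x. if moving x then weight_factor * n + 1 else n + 1)"

lemma weight_append: "weight n (u @ v) = weight (weight n u) v"
  by (simp add: weight_def)

lemma weight_Cons: "weight n (x # v) = weight (if moving x then weight_factor * n + 1 else n + 1) v"
  by (simp add: weight_def)

lemma weight_Nil: "weight n [] = n"
  by (simp add: weight_def)

lemma weight_static: "\<forall>x\<in>set w. \<not> moving x \<Longrightarrow> weight n w = n + length w"
  by (induction w arbitrary: n) (simp_all add: weight_Cons weight_Nil)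

lemma weight_strict_mono: "m < n \<Longrightarrow> weight m w < weight n w"
proof (induction w arbitrary: m n)
  case (Cons x w)
  have "0 < weight_factor" by (simp add: weight_factor_def)
  then show ?case
    using Cons by (simp add: weight_Cons)
qed (simp add: weight_Nil)

lemma push_length_less:
  "length (push1 f) + 2 < weight_factor" "length (push2 f) + 2 < weight_factor"
proof -
  have "length (push1 f) + length (push2 f) \<le> (\<Sum>f\<in>UNIV. length (push1 f) + length (push2 f))"
    by (rule member_le_sum) simp_all
  then show "length (push1 f) + 2 < weight_factor" "length (push2 f) + 2 < weight_factor"
    by (simp_all add: weight_factor_def)
qed

lemma base_rules_length:
  assumes "(l, r) \<in> base_rules"
  shows "length r < weight_factor"
  using assms push_length_less by cases (simp_all add: weight_factor_def less_diff_conv)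

text \<open>The moving letter jumps over at least one static letter, which saves at least
  \<open>weight_factor\<close>, while the static letters now behind it number fewer than that. The
  initial value \<open>n\<close> is arbitrary because it stands for the weight of the left
  context.\<close>

lemma weight_rule:
  assumes "(l, r) \<in> rules"
  shows "weight n r < weight n l"
  using assms
proof (cases rule: rules_cases)
  case base
  obtain xs m m' ys where h: "l = xs @ [m]" "xs \<noteq> []" "moving m" "\<forall>x\<in>set xs. \<not> moving x"
    "r = m' # ys" "moving m'" "\<forall>y\<in>set ys. \<not> moving y"
    using base_rule_shape[OF base] by blast
  have "weight n r = weight_factor * n + 1 + length ys"
    using h by (simp add: weight_Cons weight_static)
  also have "\<dots> < weight_factor * n + weight_factor + 1"
    using base_rules_length[OF base] h(5) by simp
  also have "\<dots> = weight_factor * (n + 1) + 1"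
    by simp
  also have "\<dots> \<le> weight_factor * (n + length xs) + 1"
    using h(2) by (intro add_right_mono mult_le_mono2) (simp add: Suc_le_eq)
  also have "\<dots> = weight n l"
    using h by (simp add: weight_append weight_Cons weight_Nil weight_static)
  finally show ?thesis .
next
  case (absorb x)
  have "1 < weight_factor" by (simp add: weight_factor_def)
  then show ?thesis
    unfolding absorb by (cases x) (simp_all add: weight_Cons weight_Nil)
qed

lemma wf_step: "wf (step\<inverse>)"
proof (rule wf_subset)
  show "wf (measure (weight 0))" by (rule wf_measure)
  show "step\<inverse> \<subseteq> measure (weight 0)"
  proof (rule subrelI)
    fix y x assume "(y, x) \<in> step\<inverse>"
    then obtain a l r b where "(l, r) \<in> rules" "x = a @ l @ b" "y = a @ r @ b"
      unfolding converse_iff step_iff by blast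
    then show "(y, x) \<in> measure (weight 0)"
      using weight_strict_mono[OF weight_rule, of l r] by (simp add: weight_append)
  qed
qed

section \<open>Confluence from overlapping redexes\<close>

lemma absorb_steps: "(Halt # w, fuels_of w @ [Halt]) \<in> step\<^sup>*"
proof (induction w)
  case (Cons x w)
  have "([] @ [Halt, x] @ w, [] @ (fuel_of x @ [Halt]) @ w) \<in> step"
    unfolding step_iff using absorb_rule by blast
  then have "(Halt # x # w, fuel_of x @ Halt # w) \<in> step" by simp
  also have "(fuel_of x @ Halt # w, fuel_of x @ fuels_of w @ [Halt]) \<in> step\<^sup>*"
    using steps_context[OF Cons.IH, of "fuel_of x" "[]"] by simp
  finally show ?case by simp
qed simp

lemma first_moving_unique:
  assumes "xs @ m # b = ys @ m' # b'" and "moving m" "moving m'"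
    and "\<forall>x\<in>set xs. \<not> moving x" "\<forall>y\<in>set ys. \<not> moving y"
  shows "xs = ys \<and> m = m' \<and> b = b'"
  using assms(1,4,5)
proof (induction xs arbitrary: ys)
  case Nil
  then show ?case using assms(2) by (cases ys) auto
next
  case (Cons x xs)
  then show ?case using assms(3) by (cases ys) auto
qed

text \<open>Overlapping base redexes both end at the first moving letter, hence at the same place,
  and are equal because one left-hand side is a suffix of the other. As \<open>Halt\<close> is in no
  base left-hand side, the remaining proper overlap has \<open>Halt\<close> directly before a redex;
  there absorption takes both results to the same fuel followed by \<open>Halt\<close>.\<close>

lemma overlap_joinable:
  assumes l: "(d @ e, r) \<in> rules" and l': "(l', r') \<in> rules" and e: "e \<noteq> []"
    and eq: "e @ b = l' @ b'"
  shows "\<exists>w. (r @ b, w) \<in> step\<^sup>* \<and> (d @ r' @ b', w) \<in> step\<^sup>*"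
  using l
proof (cases rule: rules_cases)
  case base
  obtain xs m where h: "d @ e = xs @ [m]" "moving m" "Halt \<notin> set (d @ e)" "\<forall>x\<in>set xs. \<not> moving x"
    using base_rule_shape[OF base] by blast
  obtain xs2 where xs2: "e = xs2 @ [m]" "xs = d @ xs2"
    using h(1) e by (cases e rule: rev_cases) auto
  from l' show ?thesis
  proof (cases rule: rules_cases)
    case base': base
    obtain ys m' where h': "l' = ys @ [m']" "moving m'" "\<forall>x\<in>set ys. \<not> moving x"
      using base_rule_shape[OF base'] by blast
    have "xs2 @ m # b = ys @ m' # b'"
      using eq xs2(1) h'(1) by simp
    then have "xs2 = ys \<and> m = m' \<and> b = b'"
      by (rule first_moving_unique) (use h h' xs2 in auto)
    then have "e = l'" "b = b'"
      using xs2(1) h'(1) by auto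
    then have "d = []" "r = r'"
      using base_rules_suffix_unique[of d l' r r'] base base' by auto
    then show ?thesis
      using \<open>b = b'\<close> by auto
  next
    case (absorb x)
    then have "Halt \<in> set e"
      using eq e by (cases e) auto
    then show ?thesis
      using h(3) by simp
  qed
next
  case (absorb x)
  then consider "d = []" "e = [Halt, x]" | "d = [Halt]" "e = [x]"
    using e by (cases d) (auto simp: Cons_eq_append_conv append_eq_Cons_conv)
  then show ?thesis
  proof cases
    case 1
    from l' show ?thesis
    proof (cases rule: rules_cases)
      case base
      then obtain xs m where "l' = xs @ [m]" "xs \<noteq> []" "Halt \<notin> set l'"
        using base_rule_shape by blast
      then show ?thesis
        using eq 1 by (cases xs) auto
    next
      case absorb': (absorb y)
      then show ?thesis
        using eq 1 absorb by auto
    qed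
  next
    case 2
    have "fuels_of r' = fuels_of l'"
      using l'
    proof (cases rule: rules_cases)
      case base
      then show ?thesis using base_rule_shape by blast
    next
      case (absorb y)
      then show ?thesis by (cases y) auto
    qed
    have "(d @ r' @ b', fuels_of r' @ fuels_of b' @ [Halt]) \<in> step\<^sup>*"
      using absorb_steps[of "r' @ b'"] 2 by simp
    moreover have "(r @ b, fuel_of x @ fuels_of b @ [Halt]) \<in> step\<^sup>*"
      using steps_context[OF absorb_steps[of b], of "fuel_of x" "[]"] absorb by simp
    moreover have "fuel_of x @ fuels_of b = fuels_of l' @ fuels_of b'"
      using eq 2 by (metis append_Cons append_Nil concat.simps(2) concat_append list.simps(9) map_append)
    ultimately show ?thesis
      using \<open>fuels_of r' = fuels_of l'\<close> by (metis append.assoc)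
  qed
qed

lemma aligned_joinable:
  assumes l: "(l, r) \<in> rules" and l': "(l', r') \<in> rules" and eq: "l @ b = d @ l' @ b'"
  shows "\<exists>w. (r @ b, w) \<in> step\<^sup>* \<and> (d @ r' @ b', w) \<in> step\<^sup>*"
proof -
  consider c where "d = l @ c" "b = c @ l' @ b'" | e where "l = d @ e" "e \<noteq> []" "e @ b = l' @ b'"
  proof -
    consider us where "l @ us = d" "b = us @ l' @ b'" | us where "l = d @ us" "us @ b = l' @ b'"
      using eq unfolding append_eq_append_conv2[of l b] by blast
    then show ?thesis
      by cases (use that in \<open>metis append.right_neutral append_Nil\<close>)+
  qed
  then show ?thesis
  proof cases
    case 1
    have "((r @ c) @ l' @ b', (r @ c) @ r' @ b') \<in> step"
      unfolding step_iff using l' by blast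
    moreover have "([] @ l @ (c @ r' @ b'), [] @ r @ (c @ r' @ b')) \<in> step"
      unfolding step_iff using l by blast
    ultimately show ?thesis
      using 1 by (metis append.assoc append_Nil r_into_rtrancl)
  next
    case 2
    then show ?thesis
      using overlap_joinable[of d e r l' r' b b'] l l' by blast
  qed
qed

lemma locally_confluent:
  assumes "(x, y) \<in> step" and "(x, z) \<in> step"
  shows "\<exists>w. (y, w) \<in> step\<^sup>* \<and> (z, w) \<in> step\<^sup>*"
proof -
  obtain a l r b where 1: "(l, r) \<in> rules" "x = a @ l @ b" "y = a @ r @ b"
    using assms(1) unfolding step_iff by blast
  obtain a' l' r' b' where 2: "(l', r') \<in> rules" "x = a' @ l' @ b'" "z = a' @ r' @ b'"
    using assms(2) unfolding step_iff by blast
  have "a @ l @ b = a' @ l' @ b'"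
    using 1 2 by simp
  then consider d where "a' = a @ d" "l @ b = d @ l' @ b'" | d where "a = a' @ d" "l' @ b' = d @ l @ b"
    unfolding append_eq_append_conv2[of a] by metis
  then show ?thesis
  proof cases
    case (1 d)
    then obtain w where "(r @ b, w) \<in> step\<^sup>*" "(d @ r' @ b', w) \<in> step\<^sup>*"
      using aligned_joinable \<open>(l, r) \<in> rules\<close> 2(1) by blast
    then have "(a @ (r @ b) @ [], a @ w @ []) \<in> step\<^sup>*" "(a @ (d @ r' @ b') @ [], a @ w @ []) \<in> step\<^sup>*"
      by (blast intro: steps_context)+
    then show ?thesis
      using 1 2 \<open>y = _\<close> by auto
  next
    case (2 d)
    then obtain w where "(r' @ b', w) \<in> step\<^sup>*" "(d @ r @ b, w) \<in> step\<^sup>*"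
      using aligned_joinable \<open>(l', r') \<in> rules\<close> 1(1) by blast
    then have "(a' @ (r' @ b') @ [], a' @ w @ []) \<in> step\<^sup>*" "(a' @ (d @ r @ b) @ [], a' @ w @ []) \<in> step\<^sup>*"
      by (blast intro: steps_context)+
    then show ?thesis
      using 1 2 \<open>z = _\<close> by auto
  qed
qed

lemma confluent:
  "(x, y) \<in> step\<^sup>* \<Longrightarrow> (x, z) \<in> step\<^sup>* \<Longrightarrow> \<exists>w. (y, w) \<in> step\<^sup>* \<and> (z, w) \<in> step\<^sup>*"
  by (rule confluent_if_locally_confluent[OF wf_step]) (rule locally_confluent)

lemma complete_rules: "complete_presentation UNIV rules"
  using wf_step confluent
  unfolding complete_presentation_def noetherian_iff_wf confluent_presentation_def lists_UNIV by blast

end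

section \<open>Halting as conjugacy\<close>

text \<open>
  The letters act from the right on the following states, compatibly with the rules as long as
  \<open>Dead\<close> is avoided. A run in which some instruction does not apply ends in \<open>Stuck\<close>; a further \<open>Mark\<close> or
  \<open>Halt\<close> leads from there to \<open>Dead\<close>, so a word with a \<open>Halt\<close> cannot be reached from a stuck one.
\<close>

datatype ('m, 'p, 'c) queue_state =
  Start | In_First 'm "'p list" | In_Second 'm "'p list" "'c list" | Full 'm "'p list" "'c list" |
  Halted | Stuck | Dead

context two_queue_machine
begin

section \<open>Halting runs as reductions\<close>

definition config :: "'m \<Rightarrow> 'p list \<Rightarrow> 'c list \<Rightarrow> ('m, 'p, 'c, 'o) queue_letter list" where
  "config q P Q = Mark q # map First (rev P) @ Middle # map Second (rev Q) @ [Final]"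

lemma pass_second_steps: "(map Second ys @ [Inner f], Inner f # map Second ys) \<in> step\<^sup>*"
proof (induction ys)
  case (Cons y ys)
  have "(Second y # map Second ys @ [Inner f], Second y # Inner f # map Second ys) \<in> step\<^sup>*"
    using steps_context[OF Cons.IH, of "[Second y]" "[]"] by simp
  also have "(Second y # Inner f # map Second ys, Inner f # Second y # map Second ys) \<in> step"
    using step_base[OF pass_second[of y f], of "[]" "map Second ys"] by simp
  finally show ?case by simp
qed simp

lemma pass_first_steps: "(map First xs @ [Outer f], Outer f # map First xs) \<in> step\<^sup>*"
proof (induction xs)
  case (Cons x xs)
  have "(First x # map First xs @ [Outer f], First x # Outer f # map First xs) \<in> step\<^sup>*"
    using steps_context[OF Cons.IH, of "[First x]" "[]"] by simp
  also have "(First x # Outer f # map First xs, Outer f # First x # map First xs) \<in> step"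
    using step_base[OF pass_first[of x f], of "[]" "map First xs"] by simp
  finally show ?case by simp
qed simp

text \<open>The mode \<open>q\<close> is arbitrary here since it is compared with
  \<open>src f\<close> only when the fuel meets the mark. This part of the passage is shared by
  moving and halting instructions.\<close>

lemma fuel_reaches_mark:
  "(config q (pop1 f @ P) (pop2 f @ Q) @ [Fuel f],
    Mark q # Outer f # map First (rev P) @ Middle # map Second (rev (Q @ push2 f)) @ [Final])
    \<in> step\<^sup>*"
proof -
  let ?P = "map First (rev P)" and ?Q = "map Second (rev Q)"
  let ?p = "map First (rev (pop1 f))" and ?q = "map Second (rev (pop2 f))"
  have "(config q (pop1 f @ P) (pop2 f @ Q) @ [Fuel f],
      Mark q # ?P @ ?p @ Middle # ?Q @ [Inner f, Final]) \<in> step"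
    using step_base[OF enter[of f], of "Mark q # ?P @ ?p @ Middle # ?Q" "[]"]
    by (simp add: config_def)
  also have "(Mark q # ?P @ ?p @ Middle # ?Q @ [Inner f, Final],
      Mark q # ?P @ ?p @ Middle # Inner f # ?Q @ [Final]) \<in> step\<^sup>*"
    using steps_context[OF pass_second_steps[of "rev Q" f], of "Mark q # ?P @ ?p @ [Middle]" "[Final]"]
    by simp
  also have "(Mark q # ?P @ ?p @ Middle # Inner f # ?Q @ [Final],
      Mark q # ?P @ Outer f # Middle # map Second (rev (push2 f)) @ ?Q @ [Final]) \<in> step"
    using step_base[OF cross[of f], of "Mark q # ?P" "?Q @ [Final]"] by simp
  also have "(Mark q # ?P @ Outer f # Middle # map Second (rev (push2 f)) @ ?Q @ [Final],
      Mark q # Outer f # ?P @ Middle # map Second (rev (push2 f)) @ ?Q @ [Final]) \<in> step\<^sup>*"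
    using steps_context[OF pass_first_steps[of "rev P" f], of "[Mark q]"
      "Middle # map Second (rev (push2 f)) @ ?Q @ [Final]"] by simp
  finally show ?thesis
    by simp
qed

lemma config_move:
  assumes "dst f = Some q"
  shows "(config (src f) (pop1 f @ P) (pop2 f @ Q) @ [Fuel f],
    Fuel f # config q (P @ push1 f) (Q @ push2 f)) \<in> step\<^sup>*"
proof -
  have "(Mark (src f) # Outer f # map First (rev P) @ Middle # map Second (rev (Q @ push2 f)) @ [Final],
      Fuel f # config q (P @ push1 f) (Q @ push2 f)) \<in> step"
    using step_base[OF leave[OF assms], of "[]"] by (simp add: config_def)
  with fuel_reaches_mark show ?thesis
    by (rule rtrancl_into_rtrancl)
qed

lemma config_halt:
  assumes "dst f = None"
  shows "(config (src f) (pop1 f @ P) (pop2 f @ Q) @ [Fuel f], [Fuel f, Halt]) \<in> step\<^sup>*"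
proof -
  let ?w = "map First (rev P) @ Middle # map Second (rev (Q @ push2 f)) @ [Final]"
  have "(Mark (src f) # Outer f # ?w, Fuel f # Halt # ?w) \<in> step"
    using step_base[OF halt[OF assms], of "[]"] by simp
  moreover have "(Fuel f # Halt # ?w, [Fuel f, Halt]) \<in> step\<^sup>*"
    using steps_context[OF absorb_steps[of ?w], of "[Fuel f]" "[]"] by simp
  ultimately show ?thesis
    using fuel_reaches_mark[of "src f" f P Q] by (meson rtrancl_trans r_into_rtrancl)
qed

text \<open>The list of instructions of the run serves as conjugator: each fuel letter leaves
  unchanged on the left, so the word that drives the run is also the word left in front of
  \<open>Halt\<close>.\<close>

lemma halts_imp_steps:
  assumes "halts q P Q"
  shows "\<exists>fs. (config q P Q @ map Fuel fs, map Fuel fs @ [Halt]) \<in> step\<^sup>*"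
  using assms
proof induction
  case (now f P Q)
  then show ?case
    using config_halt[of f P Q] by (intro exI[of _ "[f]"]) simp
next
  case (later f q P Q)
  then obtain fs where fs: "(config q (P @ push1 f) (Q @ push2 f) @ map Fuel fs, map Fuel fs @ [Halt])
      \<in> step\<^sup>*" by blast
  have "(config (src f) (pop1 f @ P) (pop2 f @ Q) @ Fuel f # map Fuel fs,
      Fuel f # config q (P @ push1 f) (Q @ push2 f) @ map Fuel fs) \<in> step\<^sup>*"
    using steps_context[OF config_move[OF later.hyps(1), of P Q], of "[]" "map Fuel fs"] by simp
  also have "(Fuel f # config q (P @ push1 f) (Q @ push2 f) @ map Fuel fs,
      Fuel f # map Fuel fs @ [Halt]) \<in> step\<^sup>*"
    using steps_context[OF fs, of "[Fuel f]" "[]"] by simp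
  finally show ?case
    by (intro exI[of _ "f # fs"]) simp
qed

section \<open>An action of words as invariant of the rewriting\<close>

fun outer :: "'o \<Rightarrow> 'm \<Rightarrow> 'p list \<Rightarrow> ('m, 'p, 'c) queue_state" where
  "outer f q P = (if q = src f then case dst f of None \<Rightarrow> Halted | Some q' \<Rightarrow> In_First q' (P @ push1 f)
     else Stuck)"

fun inner :: "'o \<Rightarrow> 'm \<Rightarrow> 'p list \<Rightarrow> 'c list \<Rightarrow> ('m, 'p, 'c) queue_state" where
  "inner f q P Q =
    (if \<exists>P'. P = pop1 f @ P' then
       case outer f q (drop (length (pop1 f)) P) of
         In_First q' P' \<Rightarrow> In_Second q' P' (Q @ push2 f)
       | s \<Rightarrow> s
     else Stuck)"

fun finalize :: "('m, 'p, 'c) queue_state \<Rightarrow> ('m, 'p, 'c) queue_state" where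
  "finalize (In_Second q P Q) = Full q P Q"
| "finalize s = s"

text \<open>A moving letter is charged at once with the effect of its whole remaining journey
  through what has been read so far. Hence its travelling does not change the resulting state, and
  fuel that has already left is ignored in \<open>Start\<close>.\<close>

fun act :: "('m, 'p, 'c) queue_state \<Rightarrow> ('m, 'p, 'c, 'o) queue_letter \<Rightarrow> ('m, 'p, 'c) queue_state" where
  "act Start x = (case x of Mark q \<Rightarrow> In_First q [] | Fuel f \<Rightarrow> Start | Halt \<Rightarrow> Halted | _ \<Rightarrow> Dead)"
| "act (In_First q P) x = (case x of
     First y \<Rightarrow> In_First q (y # P) | Middle \<Rightarrow> In_Second q P [] | Outer f \<Rightarrow> outer f q P
   | Mark _ \<Rightarrow> Dead | Halt \<Rightarrow> Dead | _ \<Rightarrow> Stuck)"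
| "act (In_Second q P Q) x = (case x of
     Second y \<Rightarrow> In_Second q P (y # Q) | Final \<Rightarrow> Full q P Q | Inner f \<Rightarrow> inner f q P Q
   | Mark _ \<Rightarrow> Dead | Halt \<Rightarrow> Dead | _ \<Rightarrow> Stuck)"
| "act (Full q P Q) x = (case x of
     Fuel f \<Rightarrow> (if \<exists>Q'. Q = pop2 f @ Q' then finalize (inner f q P (drop (length (pop2 f)) Q)) else Stuck)
   | Mark _ \<Rightarrow> Dead | Halt \<Rightarrow> Dead | _ \<Rightarrow> Stuck)"
| "act Halted x = Halted"
| "act Stuck x = (case x of Mark _ \<Rightarrow> Dead | Halt \<Rightarrow> Dead | _ \<Rightarrow> Stuck)"
| "act Dead x = Dead"

lemma act_absorbing [simp]: "foldl act Halted w = Halted" "foldl act Dead w = Dead"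
  by (induction w) simp_all

lemma act_map_First [simp]: "foldl act (In_First q P) (map First xs) = In_First q (rev xs @ P)"
  by (induction xs arbitrary: P) simp_all

lemma act_map_Second [simp]: "foldl act (In_Second q P Q) (map Second ys) = In_Second q P (rev ys @ Q)"
  by (induction ys arbitrary: Q) simp_all

lemma act_Stuck_First [simp]: "foldl act Stuck (map First xs) = Stuck"
  by (induction xs) simp_all

lemma act_Stuck_Second [simp]: "foldl act Stuck (map Second ys) = Stuck"
  by (induction ys) simp_all

lemma act_Stuck_Fuel [simp]: "foldl act Stuck (map Fuel fs) = Stuck"
  by (induction fs) simp_all

text \<open>\<open>Dead\<close> has to be excluded: from \<open>Full\<close>, a left-hand side
  beginning with \<open>Mark\<close> or \<open>Halt\<close> leads to \<open>Dead\<close>, whereas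
  the right-hand side may begin with fuel that leads to \<open>Halted\<close>.\<close>

lemma act_rule:
  assumes "(l, r) \<in> rules" and "foldl act s l \<noteq> Dead"
  shows "foldl act s r = foldl act s l"
  using assms(1)
proof (cases rule: rules_cases)
  case base
  then show ?thesis
  proof cases
    case (enter f)
    show ?thesis
      using assms(2) unfolding enter
      by (cases s; cases "rev (pop2 f)") (auto split: queue_state.splits option.splits if_splits)
  next
    case (pass_second y f)
    show ?thesis
      using assms(2) unfolding pass_second
      by (cases s) (auto split: queue_state.splits option.splits if_splits)
  next
    case (cross f)
    show ?thesis
      using assms(2) unfolding cross
      by (cases s; cases "rev (pop1 f)") (auto split: queue_state.splits option.splits if_splits)
  next
    case (pass_first x f)
    show ?thesis
      using assms(2) unfolding pass_first
      by (cases s) (auto split: queue_state.splits option.splits if_splits)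
  next
    case (leave f q)
    show ?thesis
      using assms(2) leave(3) unfolding leave(1,2)
      by (cases s) (auto split: queue_state.splits option.splits if_splits)
  next
    case (halt f)
    show ?thesis
      using assms(2) halt(3) unfolding halt(1,2)
      by (cases s) (auto split: queue_state.splits option.splits if_splits)
  qed
next
  case (absorb x)
  show ?thesis
    using assms(2) unfolding absorb by (cases s; cases x) auto
qed

lemma act_step:
  assumes "(u, v) \<in> step" and "foldl act s u \<noteq> Dead"
  shows "foldl act s v = foldl act s u"
proof -
  obtain a l r b where h: "(l, r) \<in> rules" "u = a @ l @ b" "v = a @ r @ b"
    using assms(1) unfolding step_iff by blast
  then have "foldl act (foldl act s a) l \<noteq> Dead"
    using assms(2) by auto
  then show ?thesis
    using act_rule[OF h(1)] h by simp
qed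

lemma act_steps:
  assumes "(u, v) \<in> step\<^sup>*" and "foldl act s u \<noteq> Dead"
  shows "foldl act s v = foldl act s u"
  using assms by (induction rule: rtrancl_induct) (simp_all add: act_step)

lemma act_config: "foldl act Start (config q P Q) = Full q P Q"
  by (simp add: config_def)

lemma act_fuels:
  "foldl act (Full q P Q) (map Fuel fs) \<noteq> Dead \<and>
    (foldl act (Full q P Q) (map Fuel fs) = Halted \<longrightarrow> halts q P Q)"
proof (induction fs arbitrary: q P Q)
  case (Cons f fs)
  show ?case
  proof (cases "(\<exists>P'. P = pop1 f @ P') \<and> (\<exists>Q'. Q = pop2 f @ Q') \<and> q = src f")
    case True
    then obtain P' Q' where h: "P = pop1 f @ P'" "Q = pop2 f @ Q'" "q = src f" by blast
    show ?thesis
    proof (cases "dst f")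
      case None
      then show ?thesis using h by (simp add: halts.now)
    next
      case (Some q')
      then show ?thesis
        using h Cons.IH[of q' "P' @ push1 f" "Q' @ push2 f"] by (auto intro: halts.later)
    qed
  next
    case False
    then have "act (Full q P Q) (Fuel f) = Stuck" by auto
    then show ?thesis by simp
  qed
qed simp

text \<open>Reading \<open>Halt\<close> always leads to \<open>Dead\<close> or
  \<open>Halted\<close>, and both are absorbing. By invariance a reduct of the configuration with
  fuel ends in neither of them.\<close>

lemma reduct_no_Halt:
  assumes "\<not> halts q P Q" and "(config q P Q @ map Fuel fs, s) \<in> step\<^sup>*"
  shows "Halt \<notin> set s"
proof
  assume "Halt \<in> set s"
  then obtain a b where s: "s = a @ Halt # b" by (meson split_list)
  have run: "foldl act Start (config q P Q @ map Fuel fs) = foldl act (Full q P Q) (map Fuel fs)"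
    by (simp add: act_config)
  have "foldl act Start s = foldl act (Full q P Q) (map Fuel fs)"
    using act_steps[OF assms(2), of Start] act_fuels[of q P Q fs] unfolding run by blast
  then have "foldl act Start s \<noteq> Dead" "foldl act Start s \<noteq> Halted"
    using act_fuels[of q P Q fs] assms(1) by auto
  moreover have "act t Halt = Dead \<or> act t Halt = Halted" for t
    by (cases t) simp_all
  from this[of "foldl act Start a"] have "foldl act Start s = Dead \<or> foldl act Start s = Halted"
    unfolding s by auto
  ultimately show False
    by blast
qed

section \<open>Marks and the right border of a configuration\<close>

fun is_mark :: "('m, 'p, 'c, 'o) queue_letter \<Rightarrow> bool" where
  "is_mark (Mark q) = True"
| "is_mark _ = False"

abbreviation marks :: "('m, 'p, 'c, 'o) queue_letter list \<Rightarrow> nat" where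
  "marks w \<equiv> length (filter is_mark w)"

lemma marks_static [simp]:
  "filter is_mark (map First xs) = []" "filter is_mark (map Second ys) = []"
  "filter is_mark (map Fuel fs) = []"
  by (auto simp: filter_empty_conv)

lemma marks_fuel_of [simp]: "filter is_mark (fuel_of x) = []"
  by (cases x) simp_all

lemma marks_rule:
  assumes "(l, r) \<in> rules"
  shows "marks r \<le> marks l \<and> (Halt \<notin> set l \<and> Halt \<notin> set r \<longrightarrow> marks r = marks l)"
  using assms
proof (cases rule: rules_cases)
  case base
  then show ?thesis by cases simp_all
qed simp

lemma marks_step: "(u, v) \<in> step \<Longrightarrow> marks v \<le> marks u"
  using marks_rule by (fastforce simp: step_iff)

lemma marks_steps: "(u, v) \<in> step\<^sup>* \<Longrightarrow> marks v \<le> marks u"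
  by (induction rule: rtrancl_induct) (auto dest: marks_step)

text \<open>Inside a left-hand side, only fuel can follow such a letter. A word ending in one
  therefore reacts across its right border with nothing else.\<close>

definition fuel_port :: "('m, 'p, 'c, 'o) queue_letter \<Rightarrow> bool" where
  "fuel_port x \<longleftrightarrow> x = Final \<or> (\<exists>f. x = Fuel f)"

lemma fuel_port_rule:
  assumes "(us @ vs, r) \<in> rules" and "us \<noteq> []" "vs \<noteq> []" and "fuel_port (last us)"
  shows "\<exists>f. hd vs = Fuel f"
proof -
  have "\<forall>i. Suc i < length l \<longrightarrow> fuel_port (l ! i) \<longrightarrow> (\<exists>f. l ! Suc i = Fuel f)"
    if "(l, r) \<in> rules" for l
    using that
  proof (cases rule: rules_cases)
    case base
    then show ?thesis
      by cases (auto simp: fuel_port_def nth_append nth_Cons' less_Suc_eq split: if_splits)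
  next
    case (absorb x)
    then show ?thesis by (auto simp: fuel_port_def)
  qed
  from this[OF assms(1), rule_format, of "length us - 1"] assms(2-4) show ?thesis
    by (simp add: nth_append last_conv_nth hd_conv_nth)
qed

text \<open>In the absence of \<open>Halt\<close>, a redex at the right end of such a word must be
  that of \<open>enter\<close>, which leaves \<open>Final\<close> there; any other redex does not
  touch the last letter.\<close>

lemma fuel_port_last_step:
  assumes "(u, v) \<in> step" and "Halt \<notin> set u" and "fuel_port (last u)"
  shows "fuel_port (last v)"
proof -
  obtain a l r b where h: "(l, r) \<in> rules" "u = a @ l @ b" "v = a @ r @ b"
    using assms(1) unfolding step_iff by blast
  have base: "(l, r) \<in> base_rules"
    using h(1)
  proof (cases rule: rules_cases)
    case (absorb x)
    then show ?thesis using assms(2) h(2) by simp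
  qed
  then have ne: "l \<noteq> []" "r \<noteq> []"
    using base_rule_shape[OF base] by auto
  show ?thesis
  proof (cases "b = []")
    case True
    then have "fuel_port (last l)"
      using assms(3) h(2) ne by simp
    with base have "fuel_port (last r)"
      by cases (auto simp: fuel_port_def)
    then show ?thesis
      using True h(3) ne by simp
  next
    case False
    then show ?thesis
      using assms(3) h by simp
  qed
qed

text \<open>
  If the machine does not halt, fuel is all that a configuration can take in from an irreducible word
  to its right.
\<close>

lemma separated_reducts:
  assumes "\<not> halts q P Q" and irr: "\<And>y. (g, y) \<notin> step" and hd: "g = [] \<or> (\<nexists>f. hd g = Fuel f)"
    and "((config q P Q @ map Fuel fs) @ g, z) \<in> step\<^sup>*"
  shows "\<exists>s. z = s @ g \<and> (config q P Q @ map Fuel fs, s) \<in> step\<^sup>* \<and>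
    marks s = 1 \<and> s \<noteq> [] \<and> fuel_port (last s)"
  using assms(4)
proof (induction rule: rtrancl_induct)
  case base
  have "fuel_port (last (config q P Q @ map Fuel fs))"
    by (cases fs rule: rev_cases) (simp_all add: config_def fuel_port_def)
  then show ?case
    by (intro exI[of _ "config q P Q @ map Fuel fs"]) (simp add: config_def)
next
  case (step y z)
  then obtain s where s: "y = s @ g" "(config q P Q @ map Fuel fs, s) \<in> step\<^sup>*"
    "marks s = 1" "s \<noteq> []" "fuel_port (last s)" by blast
  obtain a l r b where h: "(l, r) \<in> rules" "y = a @ l @ b" "z = a @ r @ b"
    using step.hyps(2) unfolding step_iff by blast
  \<comment> \<open>The redex lies inside \<open>s\<close>: it cannot lie in \<open>g\<close>, which
    is irreducible, and to straddle the border behind a fuel port it would need fuel at the head of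
    \<open>g\<close>.\<close>
  have "\<exists>c. s = a @ l @ c \<and> b = c @ g"
  proof -
    have "a @ l @ b = s @ g" using s h by simp
    then consider us where "s = a @ us" "l @ b = us @ g" | us where "g = us @ l @ b"
      unfolding append_eq_append_conv2[of a] by metis
    then show ?thesis
    proof cases
      case (1 us)
      then consider c where "us = l @ c" "b = c @ g" | vs where "l = us @ vs" "g = vs @ b" "vs \<noteq> []"
        unfolding append_eq_append_conv2[of l] by (metis append.right_neutral append_Nil)
      then show ?thesis
      proof cases
        case (2 vs)
        show ?thesis
        proof (cases "us = []")
          case True
          then have "(g, [] @ r @ b) \<in> step"
            unfolding step_iff using h(1) 2 by (metis append_Nil)
          then show ?thesis using irr by blast
        next
          case False
          then have "\<exists>f. hd vs = Fuel f"
            using fuel_port_rule[of us vs r] h(1) 2 s(5) 1(1) by simp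
          then show ?thesis
            using hd 2 by simp
        qed
      qed (use 1 in simp)
    next
      case 2
      then have "(g, us @ r @ b) \<in> step"
        unfolding step_iff using h(1) by blast
      then show ?thesis using irr by blast
    qed
  qed
  then obtain c where c: "s = a @ l @ c" "b = c @ g" by blast
  let ?s = "a @ r @ c"
  have "(s, ?s) \<in> step"
    unfolding step_iff c using h(1) by blast
  then have steps: "(config q P Q @ map Fuel fs, ?s) \<in> step\<^sup>*"
    using s(2) by simp
  have nh: "Halt \<notin> set s" "Halt \<notin> set ?s"
    using reduct_no_Halt[OF assms(1)] s(2) steps by blast+
  then have "marks ?s = 1"
    using marks_rule[OF h(1)] s(3) c(1) by auto
  moreover have "fuel_port (last ?s)"
    using fuel_port_last_step[OF \<open>(s, ?s) \<in> step\<close> nh(1) s(5)] .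
  moreover have "?s \<noteq> []"
    using \<open>marks ?s = 1\<close> by auto
  ultimately show ?case
    using steps h(3) c(2) by (intro exI[of _ ?s]) simp
qed

lemma normal_form_exists: "\<exists>n. (w, n) \<in> step\<^sup>* \<and> (\<forall>y. (n, y) \<notin> step)"
proof (induction w rule: wf_induct_rule[OF wf_step])
  case (1 w)
  then show ?case
    by (cases "\<exists>y. (w, y) \<in> step") (meson converse_iff converse_rtrancl_into_rtrancl, blast)
qed

lemma joinable_reduct:
  assumes "joinable UNIV rules u v" and "(u, u') \<in> step\<^sup>*" and "(v, v') \<in> step\<^sup>*"
  shows "joinable UNIV rules u' v'"
proof -
  obtain w where w: "(u, w) \<in> step\<^sup>*" "(v, w) \<in> step\<^sup>*"
    using assms(1) unfolding joinable_def by blast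
  obtain x where x: "(w, x) \<in> step\<^sup>*" "(u', x) \<in> step\<^sup>*"
    using confluent[OF w(1) assms(2)] by blast
  then have "(v, x) \<in> step\<^sup>*"
    using w(2) by (meson rtrancl_trans)
  then obtain y where "(x, y) \<in> step\<^sup>*" "(v', y) \<in> step\<^sup>*"
    using confluent[OF _ assms(3)] by blast
  then show ?thesis
    using x(2) unfolding joinable_def by (meson rtrancl_trans)
qed

text \<open>
  In the non-halting case the mark of the configuration survives on the left hand side, whereas
  the number of marks never increases on the right hand side.
\<close>

lemma joinable_imp_halts:
  assumes "joinable UNIV rules (config q P Q @ g) (g @ [Halt])"
  shows "halts q P Q"
proof (rule ccontr)
  assume nh: "\<not> halts q P Q"
  obtain n where n: "(g, n) \<in> step\<^sup>*" and irr: "\<And>y. (n, y) \<notin> step"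
    using normal_form_exists by blast
  have "joinable UNIV rules (config q P Q @ n) (n @ [Halt])"
    using joinable_reduct[OF assms] steps_context[OF n, of "config q P Q" "[]"]
      steps_context[OF n, of "[]" "[Halt]"] by simp
  \<comment> \<open>The leading fuel of \<open>n\<close> is assigned to the configuration. The
    irreducible rest \<open>g'\<close> does not start with fuel, as \<open>separated_reducts\<close>
    requires.\<close>
  define is_fuel where "is_fuel x \<longleftrightarrow> (\<exists>f. x = Fuel f)" for x :: "('m, 'p, 'c, 'o) queue_letter"
  obtain fs where fs: "takeWhile is_fuel n = map Fuel fs"
  proof -
    have "takeWhile is_fuel n \<in> lists (range Fuel)"
      unfolding in_lists_conv_set by (metis is_fuel_def rangeI set_takeWhileD)
    then show ?thesis
      using that unfolding lists_image by auto
  qed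
  define g' where "g' = dropWhile is_fuel n"
  have n_eq: "n = map Fuel fs @ g'"
    using fs g'_def by (metis takeWhile_dropWhile_id)
  have "g' = [] \<or> (\<nexists>f. hd g' = Fuel f)"
    using hd_dropWhile[of is_fuel n] unfolding g'_def is_fuel_def by blast
  moreover have "(g', y) \<notin> step" for y
  proof
    assume "(g', y) \<in> step"
    then have "(map Fuel fs @ g' @ [], map Fuel fs @ y @ []) \<in> step"
      by (intro rewrite_step_context) simp_all
    then show False
      using irr n_eq by simp
  qed
  moreover obtain z where z: "(config q P Q @ n, z) \<in> step\<^sup>*" "(n @ [Halt], z) \<in> step\<^sup>*"
    using \<open>joinable UNIV rules (config q P Q @ n) (n @ [Halt])\<close> unfolding joinable_def by blast
  ultimately obtain s where "z = s @ g'" "marks s = 1"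
    using separated_reducts[OF nh, of g' fs z] n_eq by auto
  then have "marks z = 1 + marks n"
    using n_eq by simp
  moreover have "marks z \<le> marks n"
    using marks_steps[OF z(2)] by simp
  ultimately show False by simp
qed

theorem halts_iff_conjugate:
  "halts q P Q \<longleftrightarrow>
    (\<exists>g h. joinable UNIV rules (config q P Q @ g) (g @ [Halt]) \<and>
      joinable UNIV rules ([Halt] @ h) (h @ config q P Q))"
proof
  assume "halts q P Q"
  then obtain fs where "(config q P Q @ map Fuel fs, map Fuel fs @ [Halt]) \<in> step\<^sup>*"
    using halts_imp_steps by blast
  then have "joinable UNIV rules (config q P Q @ map Fuel fs) (map Fuel fs @ [Halt])"
    unfolding joinable_def by blast
  moreover have "joinable UNIV rules ([Halt] @ [Halt]) ([Halt] @ config q P Q)"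
    unfolding joinable_def
    using absorb_steps[of "[Halt]"] absorb_steps[of "config q P Q"]
    by (auto simp: config_def)
  ultimately show "\<exists>g h. joinable UNIV rules (config q P Q @ g) (g @ [Halt]) \<and>
      joinable UNIV rules ([Halt] @ h) (h @ config q P Q)" by blast
qed (use joinable_imp_halts in blast)

text \<open>No left-hand side starts with fuel, so a fuel letter in front of an irreducible word
  gives another irreducible word. This is what rules out a zero.\<close>

lemma not_joinable_Fuel: "\<not> joinable UNIV rules ([Fuel f] @ w) w"
proof
  assume join: "joinable UNIV rules ([Fuel f] @ w) w"
  obtain n where n: "(w, n) \<in> step\<^sup>*" and irr: "\<And>y. (n, y) \<notin> step"
    using normal_form_exists by blast
  have irr': "(Fuel f # n, y) \<notin> step" for y
  proof
    assume "(Fuel f # n, y) \<in> step"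
    then obtain a l r b where h: "(l, r) \<in> rules" "Fuel f # n = a @ l @ b" "y = a @ r @ b"
      unfolding step_iff by blast
    have "l \<noteq> [] \<and> hd l \<noteq> Fuel f"
      using h(1)
    proof (cases rule: rules_cases)
      case base
      then show ?thesis by cases (auto simp: hd_append hd_map)
    qed simp
    then obtain a' where "a = Fuel f # a'" "n = a' @ l @ b"
      using h(2) by (cases a; cases l) auto
    then show False
      using irr h(1) unfolding step_iff by blast
  qed
  have "joinable UNIV rules ([Fuel f] @ n) n"
    using joinable_reduct[OF join _ n] steps_context[OF n, of "[Fuel f]" "[]"] by simp
  then obtain z where "(Fuel f # n, z) \<in> step\<^sup>*" "(n, z) \<in> step\<^sup>*"
    unfolding joinable_def by auto
  then have "Fuel f # n = z" "n = z"
    using irr irr' by (metis converse_rtranclE)+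
  then show False by simp
qed

end

section \<open>A universal machine with two queues\<close>

text \<open>A Post system in normal form, with productions \<open>l w -> w r\<close>, extended by
  halting productions.\<close>

inductive queue_halts :: "('s list \<times> 's list option) set \<Rightarrow> 's list \<Rightarrow> bool" for R where
  now: "(l, None) \<in> R \<Longrightarrow> queue_halts R (l @ w)"
| later: "(l, Some r) \<in> R \<Longrightarrow> queue_halts R (w @ r) \<Longrightarrow> queue_halts R (l @ w)"

text \<open>The universal alphabet is fixed, while the simulated systems use unboundedly many
  symbols. Unary blocks ended by \<open>False\<close> encode all of them over two letters without
  one code being a prefix of another.\<close>

definition code :: "'s::countable \<Rightarrow> bool list" where
  "code s = replicate (to_nat s) True @ [False]"

definition codes :: "'s::countable list \<Rightarrow> bool list" where
  "codes w = concat (map code w)"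

lemma codes_simps [simp]:
  "codes [] = []" "codes (s # w) = code s @ codes w" "codes (v @ w) = codes v @ codes w"
  by (simp_all add: codes_def)

lemma code_prefix_free:
  assumes "code s @ u = code t @ v"
  shows "s = t \<and> u = v"
proof -
  have "m = n \<and> u = v" if "replicate m True @ False # u = replicate n True @ False # v" for m n
    using that
  proof (induction m arbitrary: n)
    case 0
    then show ?case by (cases n) auto
  next
    case (Suc m)
    then show ?case by (cases n) auto
  qed
  from this[of "to_nat s" "to_nat t"] assms show ?thesis
    by (simp add: code_def)
qed

text \<open>Prefix-freeness makes a match of bits a match of whole symbols, so removing the code of
  \<open>l\<close> leaves the code of a word again.\<close>

lemma codes_prefix:
  assumes "codes w = codes l @ u"
  shows "\<exists>y. w = l @ y \<and> u = codes y"
  using assms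
proof (induction l arbitrary: w)
  case (Cons s l)
  then obtain t w' where w: "w = t # w'"
    by (cases w) (auto simp: code_def)
  then have "code t @ codes w' = code s @ (codes l @ u)"
    using Cons.prems by simp
  then have "t = s" "codes w' = codes l @ u"
    using code_prefix_free by blast+
  then show ?case
    using Cons.IH w by auto
qed simp

text \<open>After the initial \<open>Copying\<close>, the machine rotates its program in mode
  \<open>Skipping\<close> until it guesses at some \<open>Semicolon\<close> that a rule is to be
  applied. \<open>Matching\<close> then removes the left-hand side from the data queue, and
  \<open>Emitting\<close> appends the right-hand side.\<close>

datatype mode = Copying | Skipping | Matching | Emitting
datatype psym = Bit bool | Arrow | Semicolon | Bang | Dollar
datatype uop = Copy psym | Skip psym | Begin | Match bool | Turn | Emit bool | Finish | Stop

instance mode :: finite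
proof
  have "(UNIV :: mode set) = {Copying, Skipping, Matching, Emitting}"
    using mode.exhaust by blast
  then show "finite (UNIV :: mode set)" by (metis finite.emptyI finite.insertI)
qed

instance psym :: finite
proof
  have "x \<in> range Bit \<union> {Arrow, Semicolon, Bang, Dollar}" for x :: psym
    by (cases x) simp_all
  moreover have "finite (range Bit \<union> {Arrow, Semicolon, Bang, Dollar})"
    by simp
  ultimately show "finite (UNIV :: psym set)"
    by (meson finite_subset subsetI)
qed

instance uop :: finite
proof
  have "x \<in> range Copy \<union> range Skip \<union> range Match \<union> range Emit \<union> {Begin, Turn, Finish, Stop}"
    for x :: uop
    by (cases x) simp_all
  moreover have
    "finite (range Copy \<union> range Skip \<union> range Match \<union> range Emit \<union> {Begin, Turn, Finish, Stop})"
    by simp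
  ultimately show "finite (UNIV :: uop set)"
    by (meson finite_subset subsetI)
qed

type_synonym uletter = "(mode, psym, bool, uop) queue_letter"

instance tape_symbol :: (countable) countable
  by countable_datatype

datatype qsym = Kappa | Hash | State nat | Tape "nat tape_symbol"

instance qsym :: countable
  by countable_datatype

text \<open>\<open>Kappa\<close> marks the end of the copy of the program, \<open>Hash\<close> the ends of the tape.\<close>

definition letter_sym :: "uletter \<Rightarrow> qsym" where
  "letter_sym x = Tape (Letter (to_nat x))"

text \<open>
  All instructions rotate the program queue. \<open>Copy\<close> appends the code of the program symbol, seen as a
  letter of the alphabet, to the data queue.
\<close>

fun usrc :: "uop \<Rightarrow> mode" where
  "usrc (Copy x) = Copying"
| "usrc (Skip x) = Skipping"
| "usrc Begin = Skipping"
| "usrc (Match b) = Matching"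
| "usrc Turn = Matching"
| "usrc (Emit b) = Emitting"
| "usrc Finish = Emitting"
| "usrc Stop = Matching"

fun udst :: "uop \<Rightarrow> mode option" where
  "udst (Copy x) = Some (if x = Dollar then Skipping else Copying)"
| "udst (Skip x) = Some Skipping"
| "udst Begin = Some Matching"
| "udst (Match b) = Some Matching"
| "udst Turn = Some Emitting"
| "udst (Emit b) = Some Emitting"
| "udst Finish = Some Skipping"
| "udst Stop = None"

fun urot :: "uop \<Rightarrow> psym list" where
  "urot (Copy x) = [x]"
| "urot (Skip x) = [x]"
| "urot Begin = [Semicolon]"
| "urot (Match b) = [Bit b]"
| "urot Turn = [Arrow]"
| "urot (Emit b) = [Bit b]"
| "urot Finish = [Semicolon]"
| "urot Stop = [Bang]"

fun upop :: "uop \<Rightarrow> bool list" where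
  "upop (Match b) = [b]"
| "upop _ = []"

fun upush :: "uop \<Rightarrow> bool list" where
  "upush (Copy x) = code (letter_sym (First x)) @ (if x = Dollar then code Kappa else [])"
| "upush (Emit b) = [b]"
| "upush _ = []"

interpretation U: two_queue_machine usrc udst urot urot upop upush .

text \<open>With \<open>x\<close> in front, \<open>Copy x\<close> is the only instruction that
  applies in this mode. Copying is thus deterministic and the equivalence holds in both
  directions.\<close>

lemma halts_Copying:
  "U.halts Copying (x # P) Q \<longleftrightarrow>
    U.halts (if x = Dollar then Skipping else Copying) (P @ [x]) (Q @ upush (Copy x))"
proof
  assume "U.halts Copying (x # P) Q"
  then show "U.halts (if x = Dollar then Skipping else Copying) (P @ [x]) (Q @ upush (Copy x))"
  proof cases
    case (now f P' Q')
    then show ?thesis by (cases f) simp_all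
  next
    case (later f q P' Q')
    then show ?thesis by (cases f) simp_all
  qed
next
  assume "U.halts (if x = Dollar then Skipping else Copying) (P @ [x]) (Q @ upush (Copy x))"
  then show "U.halts Copying (x # P) Q"
    using U.halts.later[of "Copy x" _ P Q] by simp
qed

lemma halts_copy_program:
  assumes "Dollar \<notin> set xs"
  shows "U.halts Copying (xs @ Dollar # P) Q \<longleftrightarrow>
    U.halts Skipping (P @ xs @ [Dollar])
      (Q @ codes (map (letter_sym \<circ> First) (xs @ [Dollar]) @ [Kappa]))"
  using assms
proof (induction xs arbitrary: P Q)
  case (Cons x xs)
  then have "x \<noteq> Dollar" by auto
  then show ?case
    using Cons.prems Cons.IH[of "P @ [x]" "Q @ code (letter_sym (First x))"]
    by (simp add: halts_Copying)
qed (simp add: halts_Copying)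

lemma halts_Skip: "U.halts Skipping (P @ xs) Q \<Longrightarrow> U.halts Skipping (xs @ P) Q"
proof (induction xs arbitrary: P)
  case (Cons x xs)
  then have "U.halts Skipping (xs @ P @ [x]) Q"
    using Cons.IH[of "P @ [x]"] by simp
  then show ?case
    using U.halts.later[of "Skip x" Skipping "xs @ P" Q] by simp
qed simp

lemma halts_Match:
  "U.halts Matching (P @ map Bit m) Q \<Longrightarrow> U.halts Matching (map Bit m @ P) (m @ Q)"
proof (induction m arbitrary: P)
  case (Cons b m)
  then have "U.halts Matching (map Bit m @ P @ [Bit b]) (m @ Q)"
    using Cons.IH[of "P @ [Bit b]"] by simp
  then show ?case
    using U.halts.later[of "Match b" Matching "map Bit m @ P" "m @ Q"] by simp
qed simp

lemma halts_Emit: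
  "U.halts Emitting (P @ map Bit e) (Q @ e) \<Longrightarrow> U.halts Emitting (map Bit e @ P) Q"
proof (induction e arbitrary: P Q)
  case (Cons b e)
  then have "U.halts Emitting (map Bit e @ P @ [Bit b]) (Q @ [b])"
    using Cons.IH[of "P @ [Bit b]" "Q @ [b]"] by simp
  then show ?case
    using U.halts.later[of "Emit b" Emitting "map Bit e @ P" Q] by simp
qed simp

section \<open>Programs and the execution of their rules\<close>

fun rule_body :: "'s::countable list \<times> 's list option \<Rightarrow> psym list" where
  "rule_body (l, None) = map Bit (codes l) @ [Bang]"
| "rule_body (l, Some r) = map Bit (codes l) @ Arrow # map Bit (codes r)"

text \<open>The \<open>Semicolon\<close> of the empty list lets \<open>Finish\<close> end the last
  rule in the same way as the others.\<close>

fun program_body :: "('s::countable list \<times> 's list option) list \<Rightarrow> psym list" where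
  "program_body [] = [Semicolon]"
| "program_body (\<rho> # Rs) = Semicolon # rule_body \<rho> @ program_body Rs"

definition program :: "('s::countable list \<times> 's list option) list \<Rightarrow> psym list" where
  "program Rs = program_body Rs @ [Dollar]"

lemma not_in_rule_body: "Semicolon \<notin> set (rule_body \<rho>)" "Dollar \<notin> set (rule_body \<rho>)"
  by (induction \<rho> rule: rule_body.induct; auto)+

lemma Dollar_notin_program_body: "Dollar \<notin> set (program_body Rs)"
  using not_in_rule_body(2) by (induction Rs) auto

lemma program_body_split:
  assumes "\<rho> \<in> set Rs"
  shows "\<exists>p s. program Rs = p @ Semicolon # rule_body \<rho> @ Semicolon # s"
  using assms
proof (induction Rs)
  case (Cons \<rho>' Rs)
  show ?case
  proof (cases "\<rho> = \<rho>'")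
    case True
    obtain s where "program_body Rs @ [Dollar] = Semicolon # s"
      by (cases Rs) auto
    then show ?thesis
      using True by (intro exI[of _ "[]"] exI[of _ s]) (simp add: program_def)
  next
    case False
    then obtain p s where "program Rs = p @ Semicolon # rule_body \<rho> @ Semicolon # s"
      using Cons by auto
    then show ?thesis
      by (intro exI[of _ "Semicolon # rule_body \<rho>' @ p"] exI[of _ s]) (simp add: program_def)
  qed
qed simp

lemma queue_halts_imp_halts:
  assumes "queue_halts (set Rs) w"
  shows "U.halts Skipping (program Rs) (codes w)"
  using assms
proof induction
  case (now l w)
  obtain p s where p: "program Rs = p @ Semicolon # rule_body (l, None) @ Semicolon # s"
    using program_body_split[OF now] by blast
  let ?P = "Semicolon # s @ p @ [Semicolon]"
  have "U.halts Matching (Bang # ?P @ map Bit (codes l)) (codes w)"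
    using U.halts.now[of Stop "?P @ map Bit (codes l)" "codes w"] by simp
  then have "U.halts Matching (map Bit (codes l) @ Bang # ?P) (codes (l @ w))"
    using halts_Match[of "Bang # ?P"] by simp
  then have "U.halts Skipping (Semicolon # map Bit (codes l) @ Bang # Semicolon # s @ p) (codes (l @ w))"
    using U.halts.later[of Begin Matching "map Bit (codes l) @ Bang # Semicolon # s @ p"] by simp
  then show ?case
    using halts_Skip[of "Semicolon # map Bit (codes l) @ Bang # Semicolon # s" p] p by simp
next
  case (later l r w)
  obtain p s where p: "program Rs = p @ Semicolon # rule_body (l, Some r) @ Semicolon # s"
    using program_body_split[OF later.hyps(1)] by blast
  let ?l = "map Bit (codes l)" and ?r = "map Bit (codes r)"
  \<comment> \<open>The run is assembled from its end. Skipping over \<open>s\<close> brings the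
    program back to its original rotation, in which the induction hypothesis speaks of it.\<close>
  have "U.halts Skipping (s @ p @ Semicolon # ?l @ Arrow # ?r @ [Semicolon]) (codes (w @ r))"
    using later.IH halts_Skip[of "p @ Semicolon # ?l @ Arrow # ?r @ [Semicolon]" s] p by simp
  then have "U.halts Emitting (Semicolon # s @ p @ Semicolon # ?l @ Arrow # ?r) (codes (w @ r))"
    using U.halts.later[of Finish Skipping "s @ p @ Semicolon # ?l @ Arrow # ?r"] by simp
  then have "U.halts Emitting (?r @ Semicolon # s @ p @ Semicolon # ?l @ [Arrow]) (codes w)"
    using halts_Emit[of "Semicolon # s @ p @ Semicolon # ?l @ [Arrow]" "codes r"] by simp
  then have "U.halts Matching (Arrow # ?r @ Semicolon # s @ p @ Semicolon # ?l) (codes w)"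
    using U.halts.later[of Turn Emitting "?r @ Semicolon # s @ p @ Semicolon # ?l"] by simp
  then have "U.halts Matching (?l @ Arrow # ?r @ Semicolon # s @ p @ [Semicolon]) (codes (l @ w))"
    using halts_Match[of "Arrow # ?r @ Semicolon # s @ p @ [Semicolon]" "codes l"] by simp
  then have "U.halts Skipping (Semicolon # ?l @ Arrow # ?r @ Semicolon # s @ p) (codes (l @ w))"
    using U.halts.later[of Begin Matching "?l @ Arrow # ?r @ Semicolon # s @ p"] by simp
  then show ?case
    using halts_Skip[of "Semicolon # ?l @ Arrow # ?r @ Semicolon # s" p] p by simp
qed

section \<open>Soundness of the universal machine\<close>

lemma map_Bit_unique:
  assumes "map Bit m @ x # u = map Bit n @ y # v" and "x \<notin> range Bit" "y \<notin> range Bit"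
  shows "m = n \<and> x = y \<and> u = v"
  using assms(1)
proof (induction m arbitrary: n)
  case Nil
  then show ?case using assms(2) by (cases n) auto
next
  case (Cons b m)
  then show ?case using assms(3) by (cases n) auto
qed

lemma split_at_notin:
  assumes "a @ s = p @ x # t" and "x \<notin> set a"
  shows "\<exists>p'. p = a @ p' \<and> s = p' @ x # t"
  using assms by (auto simp: append_eq_append_conv2 append_eq_Cons_conv)

text \<open>Rule bodies contain no \<open>Semicolon\<close>, so every guess made by
  \<open>Begin\<close> hits the start of a rule or the end of the program.\<close>

lemma program_body_at_Semicolon:
  assumes "program Rs = p @ Semicolon # s"
  shows "s = [Dollar] \<or> (\<exists>\<rho>\<in>set Rs. \<exists>t. s = rule_body \<rho> @ Semicolon # t)"
  using assms
proof (induction Rs arbitrary: p)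
  case Nil
  then show ?case
    by (auto simp: program_def append_eq_Cons_conv Cons_eq_append_conv)
next
  case (Cons \<rho> Rs)
  have eq: "Semicolon # rule_body \<rho> @ program Rs = p @ Semicolon # s"
    using Cons.prems by (simp add: program_def)
  show ?case
  proof (cases p)
    case Nil
    obtain t where "program Rs = Semicolon # t"
      by (cases Rs) (auto simp: program_def)
    then show ?thesis
      using Nil eq by auto
  next
    case (Cons x p')
    then have "rule_body \<rho> @ program Rs = p' @ Semicolon # s"
      using eq by simp
    then obtain p'' where "program Rs = p'' @ Semicolon # s"
      using split_at_notin[OF _ not_in_rule_body(1)] by blast
    then show ?thesis
      using Cons.IH by auto
  qed
qed

lemma parse_Bang:
  assumes "program Rs = p @ Semicolon # map Bit m @ Bang # s"
  shows "\<exists>l. (l, None) \<in> set Rs \<and> m = codes l"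
proof -
  obtain \<rho> t where \<rho>: "\<rho> \<in> set Rs" "map Bit m @ Bang # s = rule_body \<rho> @ Semicolon # t"
    using program_body_at_Semicolon[OF assms] by (cases m) auto
  show ?thesis
  proof (cases \<rho> rule: rule_body.cases)
    case (1 l)
    then show ?thesis
      using \<rho> map_Bit_unique[of m Bang s "codes l" Bang "Semicolon # t"] by auto
  next
    case (2 l r)
    then show ?thesis
      using \<rho> map_Bit_unique[of m Bang s "codes l" Arrow "map Bit (codes r) @ Semicolon # t"] by auto
  qed
qed

lemma parse_Arrow:
  assumes "program Rs = p @ Semicolon # map Bit m @ Arrow # map Bit e @ Semicolon # s"
  shows "\<exists>l r. (l, Some r) \<in> set Rs \<and> m = codes l \<and> e = codes r"
proof -
  let ?s = "map Bit e @ Semicolon # s"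
  obtain \<rho> t where \<rho>: "\<rho> \<in> set Rs" "map Bit m @ Arrow # ?s = rule_body \<rho> @ Semicolon # t"
    using program_body_at_Semicolon[OF assms] by (cases m) auto
  show ?thesis
  proof (cases \<rho> rule: rule_body.cases)
    case (1 l)
    then show ?thesis
      using \<rho> map_Bit_unique[of m Arrow ?s "codes l" Bang "Semicolon # t"] by auto
  next
    case (2 l r)
    then have "m = codes l" "?s = map Bit (codes r) @ Semicolon # t"
      using \<rho> map_Bit_unique[of m Arrow ?s "codes l" Arrow "map Bit (codes r) @ Semicolon # t"] by auto
    then show ?thesis
      using \<rho>(1) 2 map_Bit_unique[of e Semicolon s "codes r" Semicolon t] by auto
  qed
qed

text \<open>What a halting run of the universal machine says about the encoded queue, at every stage of
  the application of a rule.\<close>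

fun sound_at ::
    "('s::countable list \<times> 's list option) list \<Rightarrow> mode \<Rightarrow> psym list \<Rightarrow> bool list \<Rightarrow> bool" where
  "sound_at Rs Copying P Q = True"
| "sound_at Rs Skipping P Q = (\<forall>p s w. program Rs = p @ s \<and> P = s @ p \<and> Q = codes w \<longrightarrow>
     queue_halts (set Rs) w)"
| "sound_at Rs Matching P Q = (\<forall>p m s w. program Rs = p @ Semicolon # map Bit m @ s \<and>
     P = s @ p @ Semicolon # map Bit m \<and> codes w = m @ Q \<longrightarrow> queue_halts (set Rs) w)"
| "sound_at Rs Emitting P Q = (\<forall>p m e s w Q'.
     program Rs = p @ Semicolon # map Bit m @ Arrow # map Bit e @ s \<and>
     P = s @ p @ Semicolon # map Bit m @ Arrow # map Bit e \<and> codes w = m @ Q' \<and> Q = Q' @ e \<longrightarrow>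
     queue_halts (set Rs) w)"

text \<open>The program ends in \<open>Dollar\<close>, so it cannot wrap around in the middle of a
  rule while bits are being matched or emitted.\<close>

lemma program_not_ending_in_Bits:
  assumes "program Rs = p @ x # map Bit m @ s" and "x \<noteq> Dollar"
  shows "s \<noteq> []"
proof
  assume "s = []"
  then have "last (program Rs) = last (x # map Bit m)"
    using assms(1) by simp
  then show False
    using assms(2) by (cases m rule: rev_cases) (simp_all add: program_def)
qed

text \<open>Along the run, \<open>m\<close> records the bits matched and \<open>e\<close> the bits
  emitted since the last \<open>Begin\<close>. The rule being applied is identified only at
  \<open>Stop\<close> or \<open>Finish\<close>, by parsing the program around these bits.\<close>

lemma halts_imp_sound:
  fixes Rs :: "('s::countable list \<times> 's list option) list"
  assumes "U.halts q P Q"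
  shows "sound_at Rs q P Q"
  using assms
proof induction
  case (now f P Q)
  then have f: "f = Stop" by (cases f) simp_all
  show ?case
    unfolding f usrc.simps sound_at.simps
  proof (intro allI impI, elim conjE)
    fix p m s and w :: "'s list"
    assume h: "program Rs = p @ Semicolon # map Bit m @ s" "urot Stop @ P = s @ p @ Semicolon # map Bit m"
      "codes w = m @ upop Stop @ Q"
    then obtain s' where "s = Bang # s'"
      using program_not_ending_in_Bits[OF h(1)] by (cases s) auto
    then obtain l where "(l, None) \<in> set Rs" "m = codes l"
      using parse_Bang h(1) by blast
    then show "queue_halts (set Rs) w"
      using codes_prefix[of w l] h(3) by (auto intro: queue_halts.now)
  qed
next
  case (later f q P Q)
  show ?case
  proof (cases f)
    case (Copy x)
    then show ?thesis by simp
  next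
    case (Skip x)
    then have IH: "sound_at Rs Skipping (P @ [x]) Q"
      using later by simp
    show ?thesis
      unfolding Skip usrc.simps sound_at.simps
    proof (intro allI impI, elim conjE)
      fix p s and w :: "'s list"
      assume h: "program Rs = p @ s" "urot (Skip x) @ P = s @ p" "upop (Skip x) @ Q = codes w"
      show "queue_halts (set Rs) w"
      proof (cases s)
        \<comment> \<open>With \<open>s\<close> empty the program is in its original rotation, so
          the split starts afresh and \<open>[x]\<close> becomes the new first part.\<close>
        case Nil
        then have "program Rs = [x] @ P" "P @ [x] = P @ [x]" "Q = codes w" using h by simp_all
        then show ?thesis using IH unfolding sound_at.simps by blast
      next
        case (Cons y s')
        then have "program Rs = (p @ [x]) @ s'" "P @ [x] = s' @ (p @ [x])" "Q = codes w"
          using h by simp_all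
        then show ?thesis using IH unfolding sound_at.simps by blast
      qed
    qed
  next
    case Begin
    then have IH: "sound_at Rs Matching (P @ [Semicolon]) Q"
      using later by simp
    show ?thesis
      unfolding Begin usrc.simps sound_at.simps
    proof (intro allI impI, elim conjE)
      fix p s and w :: "'s list"
      assume h: "program Rs = p @ s" "urot Begin @ P = s @ p" "upop Begin @ Q = codes w"
      show "queue_halts (set Rs) w"
      proof (cases s)
        case Nil
        then have "program Rs = [] @ Semicolon # map Bit [] @ P"
          "P @ [Semicolon] = P @ [] @ Semicolon # map Bit []" "codes w = [] @ Q"
          using h by simp_all
        then show ?thesis using IH unfolding sound_at.simps by blast
      next
        case (Cons y s')
        then have "program Rs = p @ Semicolon # map Bit [] @ s'"
          "P @ [Semicolon] = s' @ p @ Semicolon # map Bit []" "codes w = [] @ Q"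
          using h by simp_all
        then show ?thesis using IH unfolding sound_at.simps by blast
      qed
    qed
  next
    case (Match b)
    then have IH: "sound_at Rs Matching (P @ [Bit b]) Q"
      using later by simp
    show ?thesis
      unfolding Match usrc.simps sound_at.simps
    proof (intro allI impI, elim conjE)
      fix p m s and w :: "'s list"
      assume h: "program Rs = p @ Semicolon # map Bit m @ s"
        "urot (Match b) @ P = s @ p @ Semicolon # map Bit m" "codes w = m @ upop (Match b) @ Q"
      obtain s' where "s = Bit b # s'"
        using h(2) program_not_ending_in_Bits[OF h(1)] by (cases s) auto
      then have "program Rs = p @ Semicolon # map Bit (m @ [b]) @ s'"
        "P @ [Bit b] = s' @ p @ Semicolon # map Bit (m @ [b])" "codes w = (m @ [b]) @ Q"
        using h by simp_all
      then show "queue_halts (set Rs) w" using IH unfolding sound_at.simps by blast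
    qed
  next
    case Turn
    then have IH: "sound_at Rs Emitting (P @ [Arrow]) Q"
      using later by simp
    show ?thesis
      unfolding Turn usrc.simps sound_at.simps
    proof (intro allI impI, elim conjE)
      fix p m s and w :: "'s list"
      assume h: "program Rs = p @ Semicolon # map Bit m @ s"
        "urot Turn @ P = s @ p @ Semicolon # map Bit m" "codes w = m @ upop Turn @ Q"
      obtain s' where "s = Arrow # s'"
        using h(2) program_not_ending_in_Bits[OF h(1)] by (cases s) auto
      then have "program Rs = p @ Semicolon # map Bit m @ Arrow # map Bit [] @ s'"
        "P @ [Arrow] = s' @ p @ Semicolon # map Bit m @ Arrow # map Bit []"
        "codes w = m @ Q" "Q = Q @ []"
        using h by simp_all
      then show "queue_halts (set Rs) w" using IH unfolding sound_at.simps by blast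
    qed
  next
    case (Emit b)
    then have IH: "sound_at Rs Emitting (P @ [Bit b]) (Q @ [b])"
      using later by simp
    show ?thesis
      unfolding Emit usrc.simps sound_at.simps
    proof (intro allI impI, elim conjE)
      fix p m e s Q' and w :: "'s list"
      assume h: "program Rs = p @ Semicolon # map Bit m @ Arrow # map Bit e @ s"
        "urot (Emit b) @ P = s @ p @ Semicolon # map Bit m @ Arrow # map Bit e"
        "codes w = m @ Q'" "upop (Emit b) @ Q = Q' @ e"
      obtain s' where "s = Bit b # s'"
        using h(2) program_not_ending_in_Bits[of Rs "p @ Semicolon # map Bit m" Arrow e s] h(1)
        by (cases s) auto
      then have "program Rs = p @ Semicolon # map Bit m @ Arrow # map Bit (e @ [b]) @ s'"
        "P @ [Bit b] = s' @ p @ Semicolon # map Bit m @ Arrow # map Bit (e @ [b])"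
        "codes w = m @ Q'" "Q @ [b] = Q' @ (e @ [b])"
        using h by simp_all
      then show "queue_halts (set Rs) w" using IH unfolding sound_at.simps by blast
    qed
  next
    case Finish
    then have IH: "sound_at Rs Skipping (P @ [Semicolon]) Q"
      using later by simp
    show ?thesis
      unfolding Finish usrc.simps sound_at.simps
    proof (intro allI impI, elim conjE)
      fix p m e s Q' and w :: "'s list"
      assume h: "program Rs = p @ Semicolon # map Bit m @ Arrow # map Bit e @ s"
        "urot Finish @ P = s @ p @ Semicolon # map Bit m @ Arrow # map Bit e"
        "codes w = m @ Q'" "upop Finish @ Q = Q' @ e"
      obtain s' where s': "s = Semicolon # s'"
        using h(2) program_not_ending_in_Bits[of Rs "p @ Semicolon # map Bit m" Arrow e s] h(1)
        by (cases s) auto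
      then obtain l r where lr: "(l, Some r) \<in> set Rs" "m = codes l" "e = codes r"
        using parse_Arrow h(1) by blast
      then obtain y where y: "w = l @ y" "Q' = codes y"
        using codes_prefix h(3) by blast
      have "program Rs = (p @ Semicolon # map Bit m @ Arrow # map Bit e @ [Semicolon]) @ s'"
        "P @ [Semicolon] = s' @ (p @ Semicolon # map Bit m @ Arrow # map Bit e @ [Semicolon])"
        "Q = codes (y @ r)"
        using h s' y lr by simp_all
      then have "queue_halts (set Rs) (y @ r)"
        using IH unfolding sound_at.simps by blast
      then show "queue_halts (set Rs) w"
        unfolding y(1) by (rule queue_halts.later[OF lr(1)])
    qed
  next
    case Stop
    then show ?thesis using later by simp
  qed
qed

theorem halts_iff_queue_halts:
  "U.halts Skipping (program Rs) (codes w) \<longleftrightarrow> queue_halts (set Rs) w"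
proof
  assume "U.halts Skipping (program Rs) (codes w)"
  then have "sound_at Rs Skipping (program Rs) (codes w)"
    by (rule halts_imp_sound)
  then show "queue_halts (set Rs) w"
    using append_Nil append_Nil2 unfolding sound_at.simps by blast
qed (rule queue_halts_imp_halts)

section \<open>Simulation of Turing machines\<close>

definition rotation :: "'s list \<Rightarrow> 's list \<Rightarrow> bool" where
  "rotation u v \<longleftrightarrow> (\<exists>n. v = rotate n u)"

lemma rotation_append: "rotation (a @ b) (b @ a)"
  unfolding rotation_def by (intro exI[of _ "length a"]) (simp add: rotate_append)

lemma rotation_trans: "rotation u v \<Longrightarrow> rotation v w \<Longrightarrow> rotation u w"
  unfolding rotation_def by (auto simp: rotate_rotate)

lemma rotation_set: "rotation u v \<Longrightarrow> set u = set v"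
  unfolding rotation_def by auto

lemma rotation_swap: "rotation (a @ b) w \<Longrightarrow> rotation (b @ a) w"
  by (rule rotation_trans[OF rotation_append])

text \<open>A symbol absent from \<open>z'\<close> can occur in the second word only at its head,
  which pins down the rotation. \<open>State\<close>, \<open>Hash\<close> and \<open>Kappa\<close>
  serve as such anchors.\<close>

lemma rotation_Cons_unique:
  assumes "rotation (s # z) (s' # z')" and "s \<notin> set z'"
  shows "s = s' \<and> z = z'"
proof -
  obtain n where "s' # z' = rotate n (s # z)"
    using assms(1) unfolding rotation_def by blast
  then obtain a b where ab: "s # z = a @ b" "s' # z' = b @ a"
    by (metis append_take_drop_id rotate_drop_take)
  show ?thesis
  proof (cases a)
    case Nil
    then show ?thesis using ab by auto
  next
    case (Cons x a')
    show ?thesis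
    proof (cases b)
      case Nil
      then show ?thesis using ab by auto
    next
      case (Cons y b')
      then show ?thesis
        using ab assms(2) \<open>a = x # a'\<close> by auto
    qed
  qed
qed

section \<open>Tapes up to trailing blanks\<close>

definition extends_by_blanks :: "'a tape_symbol list \<Rightarrow> 'a tape_symbol list \<Rightarrow> bool" where
  "extends_by_blanks xs ys \<longleftrightarrow> (\<exists>n. ys = xs @ replicate n Blank)"

lemma extends_by_blanks_refl: "extends_by_blanks xs xs"
  unfolding extends_by_blanks_def by (intro exI[of _ 0]) simp

lemma extends_by_blanks_snoc:
  assumes "extends_by_blanks xs ys"
  shows "extends_by_blanks xs (ys @ [Blank])"
proof -
  obtain n where "ys = xs @ replicate n Blank"
    using assms unfolding extends_by_blanks_def by blast
  then have "ys @ [Blank] = xs @ replicate (Suc n) Blank"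
    by (simp add: replicate_append_same)
  then show ?thesis
    unfolding extends_by_blanks_def by (rule exI)
qed

lemma extends_by_blanks_Cons:
  "extends_by_blanks xs ys \<Longrightarrow> extends_by_blanks (x # xs) (x # ys)"
  unfolding extends_by_blanks_def by auto

lemma extends_by_blanks_ConsD:
  assumes "extends_by_blanks xs (y # ys)"
  shows "first_symbol xs = y \<and> extends_by_blanks (tl xs) ys"
proof -
  obtain n where n: "y # ys = xs @ replicate n Blank"
    using assms unfolding extends_by_blanks_def by blast
  show ?thesis
  proof (cases xs)
    case Nil
    then obtain m where "n = Suc m" using n by (cases n) auto
    then show ?thesis
      using n Nil unfolding extends_by_blanks_def by auto
  next
    case (Cons x xs')
    then show ?thesis
      using n unfolding extends_by_blanks_def by auto
  qed
qed

text \<open>One more blank makes the list nonempty, so the symbol seen by the machine is explicitly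
  present even if the original tape list is empty.\<close>

lemma extends_by_blanks_snoc_cases:
  assumes "extends_by_blanks xs ys"
  obtains zs where "ys @ [Blank] = first_symbol xs # zs" "extends_by_blanks (tl xs) zs"
proof -
  obtain z zs where z: "ys @ [Blank] = z # zs"
    by (cases "ys @ [Blank]") auto
  then have "extends_by_blanks xs (z # zs)"
    using extends_by_blanks_snoc[OF assms] by simp
  then show ?thesis
    using that z extends_by_blanks_ConsD by metis
qed

text \<open>The finite set \<open>G\<close> bounds the tape symbols and keeps the rules finite. The
  word \<open>init_rhs\<close> is what replaces \<open>Kappa\<close>; it completes the copied
  program to an initial configuration.\<close>

locale simulation =
  fixes T :: "nat turing_machine" and init_rhs :: "qsym list" and G :: "nat tape_symbol set"
  assumes finite_transition: "finite (dom (transition T))"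
    and finite_G: "finite G"
    and Blank_in_G: "Blank \<in> G"
    and written_in_G: "transition T k = Some (q, y, d) \<Longrightarrow> y \<in> G"
begin

definition running :: "nat \<Rightarrow> bool" where
  "running q \<longleftrightarrow> q \<noteq> accept_state T \<and> q \<noteq> reject_state T"

definition states :: "nat set" where
  "states = insert (start_state T) ((\<lambda>(q, y, d). q) ` ran (transition T))"

text \<open>In the cyclic word the scanned symbol stands just before the state and its left
  neighbour just after it. The rule \<open>extend\<close> may add a blank at both tape ends at any
  time, and the rotations bring any place to the front of the queue.\<close>

inductive_set sim_rules :: "(qsym list \<times> qsym list option) set" where
  move_right: "running q \<Longrightarrow> transition T (q, x) = Some (q', y, Move_Right) \<Longrightarrow>
    ([Tape x, State q], Some [State q', Tape y]) \<in> sim_rules"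
| move_left: "running q \<Longrightarrow> transition T (q, x) = Some (q', y, Move_Left) \<Longrightarrow> z \<in> G \<Longrightarrow>
    ([Tape x, State q, Tape z], Some [Tape y, Tape z, State q']) \<in> sim_rules"
| extend: "([Hash], Some [Tape Blank, Hash, Tape Blank]) \<in> sim_rules"
| init: "([Kappa], Some init_rhs) \<in> sim_rules"
| rotate_tape: "x \<in> G \<Longrightarrow> ([Tape x], Some [Tape x]) \<in> sim_rules"
| rotate_state: "q \<in> states \<Longrightarrow> ([State q], Some [State q]) \<in> sim_rules"
| rotate_hash: "([Hash], Some [Hash]) \<in> sim_rules"
| stop: "([State (reject_state T)], None) \<in> sim_rules"

lemma finite_states: "finite states"
  unfolding states_def using finite_ran[OF finite_transition] by simp

lemma finite_sim_rules: "finite sim_rules"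
proof -
  let ?D = "dom (transition T)" and ?t = "\<lambda>k. the (transition T k)"
  let ?U = "(\<lambda>k. ([Tape (snd k), State (fst k)],
        Some [State (fst (?t k)), Tape (fst (snd (?t k)))])) ` ?D \<union>
      (\<lambda>(k, z). ([Tape (snd k), State (fst k), Tape z],
        Some [Tape (fst (snd (?t k))), Tape z, State (fst (?t k))])) ` (?D \<times> G) \<union>
      (\<lambda>x. ([Tape x], Some [Tape x])) ` G \<union> (\<lambda>q. ([State q], Some [State q])) ` states \<union>
      {([Hash], Some [Tape Blank, Hash, Tape Blank]), ([Kappa], Some init_rhs),
        ([Hash], Some [Hash]), ([State (reject_state T)], None)}"
  have "sim_rules \<subseteq> ?U"
  proof (rule subrelI)
    fix l r assume "(l, r) \<in> sim_rules"
    then show "(l, r) \<in> ?U"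
    proof cases
      case (move_right q x q' y)
      then show ?thesis by (intro UnI1) (auto intro!: image_eqI[of _ _ "(q, x)"])
    next
      case (move_left q x q' y z)
      then have "(l, r) \<in> (\<lambda>(k, z). ([Tape (snd k), State (fst k), Tape z],
        Some [Tape (fst (snd (?t k))), Tape z, State (fst (?t k))])) ` (?D \<times> G)"
        by (auto intro!: image_eqI[of _ _ "((q, x), z)"])
      then show ?thesis by blast
    qed auto
  qed
  moreover have "finite ?U"
    using finite_transition finite_G finite_states by simp
  ultimately show ?thesis by (rule finite_subset)
qed

text \<open>
  The left end of the tape word, read cyclically, follows its right end, and the word is read
  from right to left.
\<close>

definition queue_word :: "nat \<Rightarrow> nat tape_symbol list \<Rightarrow> nat tape_symbol list \<Rightarrow> qsym list" where
  "queue_word q ls rs = State q # map Tape ls @ Hash # map Tape (rev rs)"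

abbreviation rotatable :: "qsym set" where
  "rotatable \<equiv> insert Hash (State ` states \<union> Tape ` G)"

section \<open>From rejecting runs to halting queues\<close>

lemma queue_halts_rotate:
  assumes "set a \<subseteq> rotatable" and "queue_halts sim_rules (b @ a)"
  shows "queue_halts sim_rules (a @ b)"
  using assms
proof (induction a arbitrary: b)
  case (Cons s a)
  then have "queue_halts sim_rules (a @ b @ [s])"
    using Cons.IH[of "b @ [s]"] by simp
  moreover have "([s], Some [s]) \<in> sim_rules"
    using Cons.prems(1) by (auto intro: rotate_tape rotate_state rotate_hash)
  ultimately show ?case
    using queue_halts.later[of "[s]" "[s]" sim_rules "a @ b"] by simp
qed simp

lemma target_in_states: "transition T k = Some (q, y, d) \<Longrightarrow> q \<in> states"
  unfolding states_def by (intro insertI2 image_eqI[OF _ ranI]) auto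

lemma queue_halts_extend:
  assumes "q \<in> states" and "set ls \<subseteq> G" and "set rs \<subseteq> G"
    and "queue_halts sim_rules (queue_word q (ls @ [Blank]) (rs @ [Blank]))"
  shows "queue_halts sim_rules (queue_word q ls rs)"
proof -
  let ?ls = "map Tape ls" and ?rs = "map Tape (rev rs)"
  have rot: "set ?rs \<subseteq> rotatable" "set (State q # ?ls) \<subseteq> rotatable"
    using assms(1-3) by auto
  have "queue_halts sim_rules ((State q # ?ls @ [Tape Blank, Hash, Tape Blank]) @ ?rs)"
    using assms(4) by (simp add: queue_word_def)
  then have "queue_halts sim_rules (?rs @ State q # ?ls @ [Tape Blank, Hash, Tape Blank])"
    by (rule queue_halts_rotate[OF rot(1)])
  then have "queue_halts sim_rules ((Hash # ?rs) @ (State q # ?ls))"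
    using queue_halts.later[OF extend, of "?rs @ State q # ?ls"] by simp
  from queue_halts_rotate[OF rot(2) this] show ?thesis
    by (simp add: queue_word_def)
qed

lemma queue_halts_right:
  assumes "running q" and "transition T (q, x) = Some (q', y, Move_Right)"
    and "q \<in> states" and "set ls \<subseteq> G" and "set rs \<subseteq> G"
    and "queue_halts sim_rules (queue_word q' (y # ls) rs)"
  shows "queue_halts sim_rules (queue_word q ls (x # rs))"
proof -
  let ?w = "map Tape ls @ Hash # map Tape (rev rs)"
  have rot: "set ?w \<subseteq> rotatable" "set (State q # ?w) \<subseteq> rotatable"
    using assms(3-5) by auto
  have "queue_halts sim_rules ([State q', Tape y] @ ?w)"
    using assms(6) by (simp add: queue_word_def)
  then have "queue_halts sim_rules (?w @ [State q', Tape y])"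
    by (rule queue_halts_rotate[OF rot(1)])
  then have "queue_halts sim_rules ([Tape x] @ State q # ?w)"
    using queue_halts.later[OF move_right[OF assms(1,2)], of ?w] by simp
  from queue_halts_rotate[OF rot(2) this] show ?thesis
    by (simp add: queue_word_def)
qed

lemma queue_halts_left:
  assumes "running q" and "transition T (q, x) = Some (q', y, Move_Left)"
    and "q \<in> states" and "z \<in> G" and "set ls \<subseteq> G" and "set rs \<subseteq> G"
    and "queue_halts sim_rules (queue_word q' ls (z # y # rs))"
  shows "queue_halts sim_rules (queue_word q (z # ls) (x # rs))"
proof -
  let ?w = "map Tape ls @ Hash # map Tape (rev rs)"
  have rot: "set (?w @ [Tape y, Tape z]) \<subseteq> rotatable" "set (State q # Tape z # ?w) \<subseteq> rotatable"
    using assms(3-6) written_in_G[OF assms(2)] by auto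
  have "queue_halts sim_rules ([State q'] @ ?w @ [Tape y, Tape z])"
    using assms(7) by (simp add: queue_word_def)
  then have "queue_halts sim_rules ((?w @ [Tape y, Tape z]) @ [State q'])"
    by (rule queue_halts_rotate[OF rot(1)])
  then have "queue_halts sim_rules ([Tape x] @ State q # Tape z # ?w)"
    using queue_halts.later[OF move_left[OF assms(1,2,4)], of ?w] by simp
  from queue_halts_rotate[OF rot(2) this] show ?thesis
    by (simp add: queue_word_def)
qed

lemma set_tl_subset: "set xs \<subseteq> G \<Longrightarrow> set (tl xs) \<subseteq> G"
  by (cases xs) auto

lemma first_symbol_in_G: "set xs \<subseteq> G \<Longrightarrow> first_symbol xs \<in> G"
  using Blank_in_G by (cases xs) auto

lemma extends_by_blanks_in_G: "extends_by_blanks xs ys \<Longrightarrow> set xs \<subseteq> G \<Longrightarrow> set ys \<subseteq> G"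
  using Blank_in_G unfolding extends_by_blanks_def by auto

fun simulated :: "nat configuration \<Rightarrow> bool" where
  "simulated (q, ls, rs) \<longleftrightarrow> (q \<in> states \<longrightarrow> set ls \<subseteq> G \<longrightarrow> set rs \<subseteq> G \<longrightarrow>
    (\<forall>ls' rs'. extends_by_blanks ls ls' \<longrightarrow> extends_by_blanks rs rs' \<longrightarrow>
      queue_halts sim_rules (queue_word q ls' rs')))"

text \<open>Both tape ends are padded by one blank before the step, so that the scanned symbol and
  its left neighbour are present in the word. This is why \<open>simulated\<close> speaks of all
  paddings at once.\<close>

lemma simulated_step:
  assumes "turing_step T c c'" and "simulated c'"
  shows "simulated c"
proof -
  obtain q ls rs where c: "c = (q, ls, rs)" by (cases c) auto
  have "queue_halts sim_rules (queue_word q ls' rs')"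
    if q: "q \<in> states" and G: "set ls \<subseteq> G" "set rs \<subseteq> G"
      and ext: "extends_by_blanks ls ls'" "extends_by_blanks rs rs'" for ls' rs'
  proof (rule queue_halts_extend[OF q])
    show "set ls' \<subseteq> G" "set rs' \<subseteq> G"
      using extends_by_blanks_in_G ext G by blast+
    obtain zs where zs: "ls' @ [Blank] = first_symbol ls # zs" "extends_by_blanks (tl ls) zs"
      using extends_by_blanks_snoc_cases[OF ext(1)] by blast
    obtain xs where xs: "rs' @ [Blank] = first_symbol rs # xs" "extends_by_blanks (tl rs) xs"
      using extends_by_blanks_snoc_cases[OF ext(2)] by blast
    have G': "set zs \<subseteq> G" "set xs \<subseteq> G" "set (tl ls) \<subseteq> G" "set (tl rs) \<subseteq> G"
      "first_symbol ls \<in> G" "set (ls' @ [Blank]) \<subseteq> G"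
      using extends_by_blanks_in_G zs(2) xs(2) set_tl_subset first_symbol_in_G G
        \<open>set ls' \<subseteq> G\<close> Blank_in_G by auto
    show "queue_halts sim_rules (queue_word q (ls' @ [Blank]) (rs' @ [Blank]))"
      using assms(1) unfolding c
    proof cases
      case (left q' y)
      have "y \<in> G" "q' \<in> states"
        using written_in_G target_in_states left by blast+
      then have "queue_halts sim_rules (queue_word q' zs (first_symbol ls # y # xs))"
        using assms(2) zs(2) xs(2) G' unfolding left(1) by (simp add: extends_by_blanks_Cons)
      then show ?thesis
        unfolding zs xs using left q G' by (intro queue_halts_left) (simp_all add: running_def)
    next
      case (right q' y)
      have "y \<in> G" "q' \<in> states"
        using written_in_G target_in_states right by blast+
      then have "queue_halts sim_rules (queue_word q' (y # ls' @ [Blank]) xs)"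
        using assms(2) ext(1) xs(2) G G' unfolding right(1)
        by (simp add: extends_by_blanks_Cons extends_by_blanks_snoc)
      then show ?thesis
        unfolding xs using right q G' by (intro queue_halts_right) (simp_all add: running_def)
    qed
  qed
  then show ?thesis
    unfolding c by simp
qed

lemma rejecting_imp_queue_halts:
  assumes "turing_rejects T input" and "set input \<subseteq> G"
  shows "queue_halts sim_rules (queue_word (start_state T) [] input)"
proof -
  obtain ls rs where "(turing_step T)\<^sup>*\<^sup>* (start_state T, [], input) (reject_state T, ls, rs)"
    using assms(1) unfolding turing_rejects_def reaches_state_def by blast
  then have "simulated (start_state T, [], input)"
  proof (induction rule: converse_rtranclp_induct)
    case base
    then show ?case
      using queue_halts.now[OF stop] by (simp add: queue_word_def)
  qed (rule simulated_step)
  then show ?thesis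
    using assms(2) extends_by_blanks_refl by (auto simp: states_def)
qed

section \<open>From halting queues to rejecting runs\<close>

lemma rotation_State_queue_word:
  assumes "rotation (State p # z) (queue_word q ls rs)"
  shows "p = q \<and> z = map Tape ls @ Hash # map Tape (rev rs)"
proof -
  have "State p \<in> set (queue_word q ls rs)"
    using rotation_set[OF assms] by auto
  then have "p = q"
    by (auto simp: queue_word_def)
  then show ?thesis
    using assms unfolding queue_word_def by (auto dest!: rotation_Cons_unique)
qed

lemma rotation_Hash_queue_word:
  assumes "rotation (Hash # z) (queue_word q ls rs)"
  shows "z = map Tape (rev rs) @ State q # map Tape ls"
proof -
  have "rotation (queue_word q ls rs) (Hash # map Tape (rev rs) @ State q # map Tape ls)"
    using rotation_append[of "State q # map Tape ls" "Hash # map Tape (rev rs)"]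
    by (simp add: queue_word_def)
  with assms have "rotation (Hash # z) (Hash # map Tape (rev rs) @ State q # map Tape ls)"
    by (rule rotation_trans)
  then show ?thesis
    by (rule rotation_Cons_unique[THEN conjunct2]) auto
qed

definition represents :: "nat tape_symbol list \<Rightarrow> qsym list \<Rightarrow> bool" where
  "represents input w \<longleftrightarrow> (\<exists>q ls rs ls' rs'. rotation w (queue_word q ls' rs') \<and>
    (turing_step T)\<^sup>*\<^sup>* (start_state T, [], input) (q, ls, rs) \<and>
    extends_by_blanks ls ls' \<and> extends_by_blanks rs rs')"

lemma represents_rotate:
  assumes "represents input (a @ b)"
  shows "represents input (b @ a)"
proof -
  obtain q ls rs ls' rs' where "rotation (a @ b) (queue_word q ls' rs')"
    "(turing_step T)\<^sup>*\<^sup>* (start_state T, [], input) (q, ls, rs)"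
    "extends_by_blanks ls ls'" "extends_by_blanks rs rs'"
    using assms unfolding represents_def by blast
  moreover from this(1) have "rotation (b @ a) (queue_word q ls' rs')"
    by (rule rotation_swap)
  ultimately show ?thesis
    unfolding represents_def by blast
qed

text \<open>The word contains exactly one state and one \<open>Hash\<close>, so a rule that involves
  either of them fixes the rotation and acts on the configuration as intended. \<open>Kappa\<close>
  does not occur any more, which excludes \<open>init\<close>, and the other rules only
  rotate.\<close>

lemma represents_later:
  assumes "(l, Some r) \<in> sim_rules" and "represents input (l @ w)"
  shows "represents input (w @ r)"
proof -
  obtain q ls rs ls' rs' where rot: "rotation (l @ w) (queue_word q ls' rs')"
    and reach: "(turing_step T)\<^sup>*\<^sup>* (start_state T, [], input) (q, ls, rs)"
    and ext: "extends_by_blanks ls ls'" "extends_by_blanks rs rs'"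
    using assms(2) unfolding represents_def by blast
  from assms(1) show ?thesis
  proof cases
    case (move_right p x p' y)
    have "rotation (State p # w @ [Tape x]) (queue_word q ls' rs')"
      using rot rotation_swap[of "[Tape x]" "State p # w"] move_right(1) by simp
    then have pq: "p = q" and w: "w @ [Tape x] = map Tape ls' @ Hash # map Tape (rev rs')"
      by (auto dest: rotation_State_queue_word)
    obtain xs where xs: "rs' = x # xs" "w = map Tape ls' @ Hash # map Tape (rev xs)"
      using w by (cases rs') (auto simp flip: append_Cons append_assoc)
    have rs: "first_symbol rs = x" "extends_by_blanks (tl rs) xs"
      using ext(2) extends_by_blanks_ConsD unfolding xs(1) by blast+
    have "turing_step T (q, ls, rs) (p', y # ls, tl rs)"
      using move_right pq rs(1) by (intro turing_step.right) (simp_all add: running_def)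
    then have "(turing_step T)\<^sup>*\<^sup>* (start_state T, [], input) (p', y # ls, tl rs)"
      using reach by simp
    moreover have "rotation (w @ r) (queue_word p' (y # ls') xs)"
      using rotation_append[of w r] move_right xs(2) by (simp add: queue_word_def)
    ultimately show ?thesis
      unfolding represents_def using ext(1) rs(2) extends_by_blanks_Cons by blast
  next
    case (move_left p x p' y z)
    have "rotation (State p # Tape z # w @ [Tape x]) (queue_word q ls' rs')"
      using rot rotation_swap[of "[Tape x]" "State p # Tape z # w"] move_left(1) by simp
    then have pq: "p = q" and w: "Tape z # w @ [Tape x] = map Tape ls' @ Hash # map Tape (rev rs')"
      by (auto dest: rotation_State_queue_word)
    obtain zs where zs: "ls' = z # zs" "w @ [Tape x] = map Tape zs @ Hash # map Tape (rev rs')"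
      using w by (cases ls') auto
    obtain xs where xs: "rs' = x # xs" "w = map Tape zs @ Hash # map Tape (rev xs)"
      using zs(2) by (cases rs') (auto simp flip: append_Cons append_assoc)
    have rs: "first_symbol rs = x" "extends_by_blanks (tl rs) xs"
      using ext(2) extends_by_blanks_ConsD unfolding xs(1) by blast+
    have ls: "first_symbol ls = z" "extends_by_blanks (tl ls) zs"
      using ext(1) extends_by_blanks_ConsD unfolding zs(1) by blast+
    have "turing_step T (q, ls, rs) (p', tl ls, first_symbol ls # y # tl rs)"
      using move_left pq rs(1) by (intro turing_step.left) (simp_all add: running_def)
    then have "(turing_step T)\<^sup>*\<^sup>* (start_state T, [], input) (p', tl ls, z # y # tl rs)"
      using reach ls(1) by simp
    moreover have "rotation (w @ r) (queue_word p' zs (z # y # xs))"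
      using rotation_append[of "w @ [Tape y, Tape z]" "[State p']"] move_left xs(2)
      by (simp add: queue_word_def)
    moreover have "extends_by_blanks (z # y # tl rs) (z # y # xs)"
      using rs(2) by (simp add: extends_by_blanks_Cons)
    ultimately show ?thesis
      unfolding represents_def using ls(2) by blast
  next
    case extend
    then have "w = map Tape (rev rs') @ State q # map Tape ls'"
      using rot rotation_Hash_queue_word by simp
    then have "rotation (w @ r) (queue_word q (ls' @ [Blank]) (rs' @ [Blank]))"
      using extend rotation_append[of "map Tape (rev rs')"
        "State q # map Tape ls' @ [Tape Blank, Hash, Tape Blank]"]
      by (simp add: queue_word_def)
    then show ?thesis
      unfolding represents_def using reach ext extends_by_blanks_snoc by blast
  next
    case init
    then have "Kappa \<in> set (queue_word q ls' rs')"
      using rotation_set[OF rot] by auto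
    then show ?thesis by (auto simp: queue_word_def)
  qed (use represents_rotate[OF assms(2)] in simp_all)
qed

lemma queue_halts_represented:
  assumes "queue_halts sim_rules w" and "represents input w"
  shows "turing_rejects T input"
  using assms
proof induction
  case (now l w)
  then have l: "l = [State (reject_state T)]"
    by cases simp_all
  obtain q ls rs ls' rs' where "rotation (l @ w) (queue_word q ls' rs')"
    "(turing_step T)\<^sup>*\<^sup>* (start_state T, [], input) (q, ls, rs)"
    using now unfolding represents_def by blast
  then show ?case
    using rotation_State_queue_word[of "reject_state T" w q]
    unfolding l turing_rejects_def reaches_state_def by auto
next
  case (later l r w)
  then show ?case using represents_later by blast
qed

text \<open>As long as \<open>Kappa\<close> is present, there is no state to stop at and only tape
  symbols can rotate, until \<open>init\<close> consumes \<open>Kappa\<close>. By \<open>rot\<close>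
  the result is a rotation of the initial configuration on \<open>input\<close>.\<close>

theorem queue_halts_iff_rejects:
  assumes us: "set us \<subseteq> Tape ` G" and input: "set input \<subseteq> G"
    and rot: "us @ init_rhs = b @ a" "queue_word (start_state T) [] input = a @ b"
  shows "queue_halts sim_rules (us @ [Kappa]) \<longleftrightarrow> turing_rejects T input"
proof
  assume rej: "turing_rejects T input"
  have "set (queue_word (start_state T) [] input) \<subseteq> rotatable"
    using input by (auto simp: queue_word_def states_def)
  then have "set b \<subseteq> rotatable"
    unfolding rot(2) by auto
  then have "queue_halts sim_rules (us @ init_rhs)"
    using queue_halts_rotate[of b a] rejecting_imp_queue_halts[OF rej input] unfolding rot by blast
  then have "queue_halts sim_rules ([Kappa] @ us)"
    by (rule queue_halts.later[OF init])
  moreover have "set us \<subseteq> rotatable"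
    using us by blast
  ultimately show "queue_halts sim_rules (us @ [Kappa])"
    using queue_halts_rotate by blast
next
  \<comment> \<open>The claim is generalised to all rotations of \<open>Kappa # us\<close>, because
    \<open>rotate_tape\<close> turns the word during the induction.\<close>
  have "turing_rejects T input" if "queue_halts sim_rules w" "rotation w (Kappa # us)" for w
    using that
  proof induction
    case (now l w)
    then have "l = [State (reject_state T)]"
      by cases simp_all
    then have "State (reject_state T) \<in> set (Kappa # us)"
      using rotation_set[OF now(2)] by auto
    then show ?case using us by auto
  next
    case (later l r w)
    have nin: "State q \<notin> set (l @ w)" "Hash \<notin> set (l @ w)" for q
      using rotation_set[OF later.prems] us by auto
    from later.hyps(1) show ?case
    proof cases
      case init
      then have "rotation (Kappa # w) (Kappa # us)"
        using later.prems by simp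
      then have "w = us"
        by (rule rotation_Cons_unique[THEN conjunct2]) (use us in auto)
      then have "rotation (w @ r) (queue_word (start_state T) [] input)"
        using init rot rotation_append[of b a] by simp
      then have "represents input (w @ r)"
        unfolding represents_def using extends_by_blanks_refl by blast
      then show ?thesis
        using queue_halts_represented later.hyps(2) by blast
    next
      case (rotate_tape x)
      then have "rotation (w @ r) (Kappa # us)"
        using later.prems rotation_swap[of l w] by simp
      then show ?thesis by (rule later.IH)
    qed (use nin in auto)
  qed
  moreover have "rotation (us @ [Kappa]) (Kappa # us)"
    using rotation_append[of us "[Kappa]"] by simp
  moreover assume "queue_halts sim_rules (us @ [Kappa])"
  ultimately show "turing_rejects T input" by blast
qed

end

section \<open>Determinism of Turing machines\<close>

lemma turing_step_deterministic:
  assumes "turing_step T c d" and "turing_step T c e"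
  shows "d = e"
  using assms by cases (erule turing_step.cases; auto)+

lemma rtranclp_deterministic_final:
  assumes det: "\<And>x y z. r x y \<Longrightarrow> r x z \<Longrightarrow> y = z"
    and "r\<^sup>*\<^sup>* x y" and "r\<^sup>*\<^sup>* x z" and "\<And>w. \<not> r y w" and "\<And>w. \<not> r z w"
  shows "y = z"
  using assms(2,3)
proof (induction rule: converse_rtranclp_induct)
  case base
  then show ?case using assms(4) by (metis converse_rtranclpE)
next
  case (step x x')
  then show ?case using assms(5) det by (metis converse_rtranclpE)
qed

text \<open>No step leaves an accepting or rejecting configuration, so by determinism both runs
  would end in the same configuration, although the two states differ.\<close>

lemma not_accepts_and_rejects:
  assumes "valid_turing_machine T"
  shows "\<not> (turing_accepts T w \<and> turing_rejects T w)"
proof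
  assume "turing_accepts T w \<and> turing_rejects T w"
  then obtain ls rs ls' rs' where
    acc: "(turing_step T)\<^sup>*\<^sup>* (start_state T, [], w) (accept_state T, ls, rs)" and
    rej: "(turing_step T)\<^sup>*\<^sup>* (start_state T, [], w) (reject_state T, ls', rs')"
    unfolding turing_accepts_def turing_rejects_def reaches_state_def by blast
  have "(accept_state T, ls, rs) = (reject_state T, ls', rs')"
  proof (rule rtranclp_deterministic_final[of "turing_step T", OF turing_step_deterministic acc rej])
    show "\<not> turing_step T (accept_state T, ls, rs) c" for c
      by (auto elim: turing_step.cases)
    show "\<not> turing_step T (reject_state T, ls', rs') c" for c
      by (auto elim: turing_step.cases)
  qed
  then show False
    using assms unfolding valid_turing_machine_def by simp
qed

section \<open>The presentation over numbers and the diagonal argument\<close>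

definition conj_alphabet :: "nat set" where
  "conj_alphabet = range (to_nat :: uletter \<Rightarrow> nat)"

definition conj_rules :: "(nat list \<times> nat list) set" where
  "conj_rules = map_words to_nat U.rules"

lemma finite_presentation_conj: "finite_presentation conj_alphabet conj_rules"
proof -
  have "conj_rules \<subseteq> lists conj_alphabet \<times> lists conj_alphabet"
    unfolding conj_rules_def conj_alphabet_def by (auto simp: in_lists_conv_set)
  moreover have "finite conj_alphabet"
    unfolding conj_alphabet_def by (rule finite_imageI) (rule finite)
  moreover have "finite conj_rules"
    unfolding conj_rules_def by (rule finite_imageI) (rule U.finite_rules)
  moreover have "conj_alphabet \<noteq> {}"
    unfolding conj_alphabet_def by simp
  ultimately show ?thesis
    unfolding finite_presentation_def presentation_def by blast
qed

lemma complete_presentation_conj: "complete_presentation conj_alphabet conj_rules"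
  using U.complete_rules noetherian_map[OF inj_to_nat] confluent_map[OF inj_to_nat]
  unfolding complete_presentation_def conj_alphabet_def conj_rules_def by blast

lemma c_conjugate_iff_halts:
  "c_conjugate (presented_monoid conj_alphabet conj_rules)
      (word_class conj_alphabet conj_rules (map to_nat (U.config q P Q)))
      (word_class conj_alphabet conj_rules (map to_nat [Halt :: uletter])) \<longleftrightarrow> U.halts q P Q"
proof -
  let ?\<nu> = "to_nat :: uletter \<Rightarrow> nat"
  have lists: "w \<in> lists conj_alphabet \<longleftrightarrow> (\<exists>w'. w = map ?\<nu> w')" for w
    unfolding conj_alphabet_def by (rule lists_range_iff) simp
  have bex: "(\<exists>w\<in>lists conj_alphabet. A w) \<longleftrightarrow> (\<exists>w'. A (map ?\<nu> w'))" for A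
    unfolding Bex_def lists by blast
  have join: "joinable conj_alphabet conj_rules (map ?\<nu> u) (map ?\<nu> v) \<longleftrightarrow> joinable UNIV U.rules u v"
    for u v
    unfolding conj_alphabet_def conj_rules_def by (rule joinable_map) simp
  have no_zero: "\<exists>x\<in>lists conj_alphabet. \<not> joinable conj_alphabet conj_rules (x @ w) w"
    if "w \<in> lists conj_alphabet" for w
  proof -
    have "\<exists>w'. w = map ?\<nu> w'"
      using that unfolding lists .
    then obtain w' where "w = map ?\<nu> w'" by blast
    \<comment> \<open>Any fuel letter would do in place of \<open>Fuel Begin\<close>.\<close>
    then have "\<not> joinable conj_alphabet conj_rules (map ?\<nu> [Fuel Begin] @ w) w"
      using U.not_joinable_Fuel[of Begin w'] join[of "[Fuel Begin] @ w'" w'] by simp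
    moreover have "map ?\<nu> [Fuel Begin] \<in> lists conj_alphabet"
      unfolding lists by blast
    ultimately show ?thesis by blast
  qed
  have in_lists: "map ?\<nu> w \<in> lists conj_alphabet" for w
    unfolding lists by blast
  have pres: "presentation conj_alphabet conj_rules"
    using finite_presentation_conj unfolding finite_presentation_def by (rule conjunct1)
  have conf: "confluent_presentation conj_alphabet conj_rules"
    using complete_presentation_conj unfolding complete_presentation_def by (rule conjunct2)
  have "c_conjugate (presented_monoid conj_alphabet conj_rules)
      (word_class conj_alphabet conj_rules (map ?\<nu> (U.config q P Q)))
      (word_class conj_alphabet conj_rules (map ?\<nu> [Halt])) \<longleftrightarrow>
    (\<exists>g\<in>lists conj_alphabet. \<exists>h\<in>lists conj_alphabet.
      joinable conj_alphabet conj_rules (map ?\<nu> (U.config q P Q) @ g) (g @ map ?\<nu> [Halt]) \<and>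
      joinable conj_alphabet conj_rules (map ?\<nu> [Halt] @ h) (h @ map ?\<nu> (U.config q P Q)))"
    by (rule c_conjugate_iff_joinable[OF pres conf no_zero in_lists in_lists])
  also have "\<dots> \<longleftrightarrow> U.halts q P Q"
    unfolding U.halts_iff_conjugate bex by (simp only: join flip: map_append)
  finally show ?thesis .
qed

text \<open>The input of \<open>T\<close> contains the program \<open>Rs\<close>, and
  \<open>Rs\<close> contains \<open>init_rhs\<close>. This is not circular: \<open>init_rhs\<close>
  does not mention \<open>Rs\<close>, since the machine itself appends the copy \<open>us\<close> of
  its program to the queue.\<close>

lemma diagonal_words:
  assumes "valid_turing_machine T"
  obtains u where "c_conjugate (presented_monoid conj_alphabet conj_rules)
      (word_class conj_alphabet conj_rules (map to_nat (u :: uletter list)))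
      (word_class conj_alphabet conj_rules (map to_nat [Halt :: uletter])) \<longleftrightarrow>
    turing_rejects T (pair_input (map to_nat u) (map to_nat [Halt :: uletter]))"
proof -
  let ?\<nu> = "to_nat :: uletter \<Rightarrow> nat"
  \<comment> \<open>Read cyclically behind \<open>us\<close>, this is the initial tape from right to
    left: the mark is the first input letter and thus scanned, the state follows it, and beyond
    \<open>Hash\<close> comes the end of the input. \<open>Final\<close> and \<open>Middle\<close>
    are adjacent because the second queue of \<open>u\<close> is empty.\<close>
  define init_rhs where "init_rhs = [letter_sym (Mark Copying), State (start_state T), Hash,
    letter_sym Halt, Tape Separator, letter_sym Final, letter_sym Middle]"
  define G where "G = {Blank, Separator} \<union> Letter ` range ?\<nu> \<union> (\<lambda>(q, y, d). y) ` ran (transition T)"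
  have fin: "finite (dom (transition T))"
    using assms unfolding valid_turing_machine_def by blast
  interpret simulation T init_rhs G
  proof
    show "finite G"
      unfolding G_def using finite_ran[OF fin] by simp
    show "transition T k = Some (q, y, d) \<Longrightarrow> y \<in> G" for k q y d
      unfolding G_def by (force intro: ranI)
  qed (use fin in \<open>simp_all add: G_def\<close>)
  obtain Rs where Rs: "set Rs = sim_rules"
    using finite_list[OF finite_sim_rules] by blast
  define u where "u = U.config Copying (program Rs) []"
  define us where "us = map (letter_sym \<circ> First) (program Rs)"
  let ?input = "pair_input (map ?\<nu> u) (map ?\<nu> [Halt])"
  have "c_conjugate (presented_monoid conj_alphabet conj_rules)
      (word_class conj_alphabet conj_rules (map ?\<nu> u))
      (word_class conj_alphabet conj_rules (map ?\<nu> [Halt])) \<longleftrightarrow>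
    U.halts Copying (program Rs) []"
    unfolding u_def by (rule c_conjugate_iff_halts)
  also have "\<dots> \<longleftrightarrow> U.halts Skipping (program Rs) (codes (us @ [Kappa]))"
    using halts_copy_program[OF Dollar_notin_program_body[of Rs], of "[]" "[]"]
    by (simp add: us_def program_def)
  also have "\<dots> \<longleftrightarrow> queue_halts sim_rules (us @ [Kappa])"
    unfolding halts_iff_queue_halts Rs ..
  also have "\<dots> \<longleftrightarrow> turing_rejects T ?input"
  proof (rule queue_halts_iff_rejects)
    show "set us \<subseteq> Tape ` G"
      unfolding us_def G_def letter_sym_def by auto
    show "set ?input \<subseteq> G"
      unfolding pair_input_def G_def by auto
    show "us @ init_rhs = (us @ [letter_sym (Mark Copying)]) @ tl init_rhs"
      by (simp add: init_rhs_def)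
    show "queue_word (start_state T) [] ?input = tl init_rhs @ us @ [letter_sym (Mark Copying)]"
      by (simp add: init_rhs_def queue_word_def pair_input_def u_def U.config_def us_def
          letter_sym_def rev_map comp_def)
  qed
  finally show ?thesis
    by (rule that)
qed

lemma c_conjugacy_problem_undecidable:
  "\<not> c_conjugacy_problem_decidable conj_alphabet conj_rules"
proof
  define P where "P u v \<longleftrightarrow> c_conjugate (presented_monoid conj_alphabet conj_rules)
    (word_class conj_alphabet conj_rules u) (word_class conj_alphabet conj_rules v)" for u v
  assume "c_conjugacy_problem_decidable conj_alphabet conj_rules"
  then have "decidable_word_relation conj_alphabet P"
    unfolding c_conjugacy_problem_decidable_def P_def .
  then obtain T where T: "valid_turing_machine T" and dec: "\<forall>u\<in>lists conj_alphabet.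
      \<forall>v\<in>lists conj_alphabet. if P u v then turing_accepts T (pair_input u v)
        else turing_rejects T (pair_input u v)"
    unfolding decidable_word_relation_def by (elim exE conjE)
  define v where "v = map to_nat [Halt :: uletter]"
  obtain u' :: "uletter list" where
    u': "P (map to_nat u') v \<longleftrightarrow> turing_rejects T (pair_input (map to_nat u') v)"
    using diagonal_words[OF T] unfolding P_def v_def .
  define u where "u = map to_nat u'"
  have "u \<in> lists conj_alphabet" "v \<in> lists conj_alphabet"
    unfolding conj_alphabet_def u_def v_def by auto
  then have "if P u v then turing_accepts T (pair_input u v) else turing_rejects T (pair_input u v)"
    using dec by simp
  then show False
    using not_accepts_and_rejects[OF T, of "pair_input u v"] u' unfolding u_def
    by (simp split: if_splits)
qed

theorem proposition4p2:
  shows "\<exists>(\<Sigma> :: nat set) (R :: (nat list \<times> nat list) set).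
           finite_presentation \<Sigma> R \<and> complete_presentation \<Sigma> R \<and>
           \<not> c_conjugacy_problem_decidable \<Sigma> R"
  using finite_presentation_conj complete_presentation_conj c_conjugacy_problem_undecidable
  by blast

end
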